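(* Let $\Phi(x)=\sum_{n=1}^\infty\frac{e^{\pi i n^2x}}{\pi i n^2}$ for $x\in\mathbb{R}$ (a $2$-periodic function), and let $1\le p<\infty$. Then: (a) if $p<4/3$, then $\Phi\notin\mathcal{BV}_p(0,2)$; (b) if $p>4/3$, then $\Phi\in\mathcal{BV}_p(0,2)$.
   Context: Let $f:\mathbb{R}\to\mathbb{C}$ be periodic with period $P>0$. For $E\subset\mathbb{R}$ put $\operatorname{osc}(f;E)=\sup_{x,y\in E}|f(x)-f(y)|$. For $1\le p<\infty$ the $p$-variation of $f$ is $$\mathcal{V}_p(f;[0,P])=\sup_{\mathcal{I}}\Big(\sum_{I\in\mathcal{I}}\operatorname{osc}(f;I)^p\Big)^{1/p}\in[0,\infty],$$ where the supremum is over all finite families $\mathcal{I}$ of (pairwise) disjoint intervals contained in $[0,P]$. The class $\mathcal{BV}_p(0,P)$ consists of all $P$-periodic functions $f:\mathbb{R}\to\mathbb{C}$ with $\mathcal{V}_p(f;[0,P])<\infty$. *)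

theory Defs
  imports "HOL-Analysis.Analysis"
begin

(* Real powers on [0,\<infinity>], with the convention \<infinity>^a = \<infinity>; only used for exponents a > 0. *)
definition ennpowr :: "ennreal \<Rightarrow> real \<Rightarrow> ennreal" where
  "ennpowr x a = (if x = top then top else ennreal (enn2real x powr a))"

(* Taken in [0,\<infinity>], so that it is \<infinity> if f is unbounded on E, and 0 if E is empty. *)
definition osc :: "(real \<Rightarrow> complex) \<Rightarrow> real set \<Rightarrow> ennreal" where
  "osc f E = (SUP x\<in>E. SUP y\<in>E. ennreal (norm (f x - f y)))"

definition interval_families :: "real \<Rightarrow> real set set set" where
  "interval_families P =
     {\<I>. finite \<I> \<and> disjoint \<I> \<and> (\<forall>I\<in>\<I>. is_interval I \<and> I \<subseteq> {0..P})}"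

definition p_variation :: "real \<Rightarrow> (real \<Rightarrow> complex) \<Rightarrow> real \<Rightarrow> ennreal" where
  "p_variation p f P =
     (SUP \<I>\<in>interval_families P. ennpowr (\<Sum>I\<in>\<I>. ennpowr (osc f I) p) (1 / p))"

(* The class written BV_p(0,P), for p \<ge> 1 and P > 0. *)
definition BV :: "real \<Rightarrow> real \<Rightarrow> (real \<Rightarrow> complex) set" where
  "BV p P = {f. (\<forall>x. f (x + P) = f x) \<and> p_variation p f P < top}"

(* The summation index is shifted: n = Suc k, k \<ge> 0. *)
definition Phi :: "real \<Rightarrow> complex" where
  "Phi x = (\<Sum>k. exp (of_real pi * \<i> * of_nat (Suc k) ^ 2 * of_real x)
                    / (of_real pi * \<i> * of_nat (Suc k) ^ 2))"

end

theory Submission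
  imports Defs "HOL-Real_Asymp.Real_Asymp"
begin

text \<open>
  The frequencies \<open>n\<^sup>2\<close> with coefficients of size \<open>1 / n\<^sup>2\<close> give \<open>Phi\<close> smoothness \<open>3/4\<close> in the mean: the
  increment \<open>Phi (x + h) - Phi x\<close> has size \<open>h powr (3/4)\<close> for most \<open>x\<close>, up to logarithms. Since
  \<open>1 / h\<close> disjoint intervals of length \<open>h\<close> fit into a period, their contribution to the
  \<open>p\<close>-variation is about \<open>h powr (3 * p / 4 - 1)\<close>, and the critical exponent is \<open>4/3\<close>.

  For \<open>p > 4/3\<close> one may assume \<open>p \<le> 2\<close>, and then \<open>L\<^sup>2\<close> information suffices. The dyadic block
  \<open>f\<close> of the terms \<open>N \<le> n < 2 * N\<close> satisfies, by Parseval, \<open>\<integral>|f|\<^sup>2 \<le> 2 / N ^ 3\<close> and \<open>\<integral>|f'|\<^sup>2 = 2 * N\<close>.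
  The 1-variation of \<open>f\<close> is at most \<open>\<integral>|f'|\<close>, hence of order \<open>N powr (1/2)\<close>. The sum of the squared
  increments is at most \<open>8 * \<integral>|f| * |f'|\<close>, hence of order \<open>1 / N\<close>; this rests on
  \<open>square_diff_le_signed_squares\<close>. Interpolating between the two bounds gives
  \<open>N powr (2 - 3 * p / 2)\<close> for the sum of the \<open>p\<close>-th powers
  (\<open>sum_powr_increments_dyadic_block_le\<close>), and the blocks add up as a geometric series.

  For \<open>p < 4/3\<close> take \<open>h = 1 / K ^ 2\<close>. Parseval shows that \<open>\<integral>|Phi (x + h) - Phi x|\<^sup>2\<close> is at least
  of order \<open>h powr (3/2)\<close>, with the main share carried by the frequencies \<open>n \<le> 4 * K\<close>. A function
  with large mean square could still be concentrated on a small set and have small \<open>L\<^sup>p\<close>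
  norm; the fourth moment excludes this. It is governed by the number of solutions of
  \<open>n\<^sup>2 + m\<^sup>2 = k\<^sup>2 + l\<^sup>2\<close>, equivalently of \<open>(n - k) * (n + k) = (l - m) * (l + m)\<close>, and this number is
  \<open>N ^ 2\<close> up to logarithms (\<open>card_equal_square_sums_le\<close>). Consequently
  \<open>\<integral>|Phi (x + h) - Phi x| powr p\<close> is at least \<open>h powr (3 * p / 4)\<close> up to logarithms, whereas finite
  \<open>p\<close>-variation would force it to be \<open>O(h)\<close>; this comparison is \<open>variation_lower_bound\<close>.
\<close>

section \<open>Variation sums over separated segments\<close>

lemma osc_upper: "x \<in> E \<Longrightarrow> y \<in> E \<Longrightarrow> ennreal (norm (f x - f y)) \<le> osc f E"
  unfolding osc_def by (meson SUP_upper2 order_refl)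

lemma osc_empty: "osc f {} = 0"
  by (simp add: osc_def bot_ennreal)

lemma ennpowr_mono: "a \<ge> 0 \<Longrightarrow> x \<le> y \<Longrightarrow> ennpowr x a \<le> ennpowr y a"
  by (auto simp: ennpowr_def top_unique less_top intro!: ennreal_leI powr_mono2 enn2real_mono)

lemma ennpowr_ennreal: "r \<ge> 0 \<Longrightarrow> ennpowr (ennreal r) a = ennreal (r powr a)"
  by (simp add: ennpowr_def)

text \<open>
  Families of intervals are handled through closed segments with marked endpoints, on which one
  looks at the increment from one end to the other instead of the oscillation.
\<close>

definition separated_segments :: "real \<Rightarrow> 'a set \<Rightarrow> ('a \<Rightarrow> real) \<Rightarrow> ('a \<Rightarrow> real) \<Rightarrow> bool" where
  "separated_segments P J x y \<longleftrightarrow> finite J \<and> (\<forall>j\<in>J. 0 \<le> x j \<and> x j \<le> y j \<and> y j \<le> P) \<and>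
     disjoint_family_on (\<lambda>j. {x j..y j}) J"

lemma variation_sums_bounded:
  assumes "f \<in> BV p P" "p \<ge> 1"
  shows "\<exists>C\<ge>0. \<forall>(J::nat set) x y. separated_segments P J x y \<longrightarrow>
           (\<Sum>j\<in>J. norm (f (y j) - f (x j)) powr p) \<le> C"
proof -
  define V where "V = enn2real (p_variation p f P)"
  have fin: "p_variation p f P < top" using assms by (auto simp: BV_def)
  show ?thesis
  proof (intro exI[of _ "V powr p"] conjI allI impI)
    fix J :: "nat set" and x y :: "nat \<Rightarrow> real"
    assume sep: "separated_segments P J x y"
    define I where "I j = {x j..y j}" for j
    define S where "S = (\<Sum>E\<in>I ` J. ennpowr (osc f E) p)"
    have inj: "inj_on I J"
      using sep unfolding separated_segments_def disjoint_family_on_def I_def inj_on_def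
      by (metis Int_absorb atLeastatMost_empty_iff)
    have fam: "I ` J \<in> interval_families P"
      using sep unfolding interval_families_def separated_segments_def disjoint_family_on_def disjoint_def I_def
      by (auto simp: is_interval_cc) fastforce+
    have le: "ennpowr S (1/p) \<le> p_variation p f P"
      unfolding p_variation_def S_def using fam by (rule SUP_upper)
    then have Sfin: "S < top" using fin by (auto simp: ennpowr_def top_unique less_top split: if_splits)
    have "enn2real S powr (1/p) \<le> V"
      using enn2real_mono[OF le fin] Sfin by (simp add: ennpowr_def V_def less_top[symmetric])
    then have SV: "enn2real S \<le> V powr p"
      using powr_mono2[of p "enn2real S powr (1/p)" V] assms(2) by (simp add: powr_powr)
    have "ennreal (\<Sum>j\<in>J. norm (f (y j) - f (x j)) powr p) = (\<Sum>j\<in>J. ennpowr (ennreal (norm (f (y j) - f (x j)))) p)"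
      by (simp add: ennpowr_ennreal)
    also have "\<dots> \<le> (\<Sum>j\<in>J. ennpowr (osc f (I j)) p)"
      using assms(2) sep by (intro sum_mono ennpowr_mono osc_upper) (auto simp: I_def separated_segments_def)
    also have "\<dots> = S" unfolding S_def by (simp add: sum.reindex[OF inj])
    also have "\<dots> = ennreal (enn2real S)" using Sfin by simp
    finally show "(\<Sum>j\<in>J. norm (f (y j) - f (x j)) powr p) \<le> V powr p"
      using SV by (auto intro: order_trans simp: ennreal_le_iff)
  qed simp
qed

text \<open>
  An oscillation is a supremum and need not be attained. Giving up a factor 2 avoids
  approximating sequences and only costs a factor \<open>2 powr p\<close> in the sums.
\<close>

lemma osc_half_attained:
  assumes "E \<noteq> {}" "osc f E < top"
  shows "\<exists>x\<in>E. \<exists>y\<in>E. x \<le> y \<and> enn2real (osc f E) \<le> 2 * norm (f y - f x)"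
proof (cases "osc f E = 0")
  case True
  obtain x where "x \<in> E" using assms(1) by auto
  then show ?thesis using True by (intro bexI[of _ x]) auto
next
  case False
  define D where "D = enn2real (osc f E)"
  have D: "osc f E = ennreal D" "D > 0" using assms False by (auto simp: D_def enn2real_positive_iff less_top zero_less_iff_neq_zero)
  then have "ennreal (D/2) < osc f E" by (simp add: ennreal_less_iff)
  then obtain x y where "x\<in>E" "y\<in>E" "ennreal (D/2) < ennreal (norm (f x - f y))"
    unfolding osc_def less_SUP_iff by auto
  then have "D \<le> 2 * norm (f x - f y)" "D \<le> 2 * norm (f y - f x)"
    using D by (auto simp: ennreal_less_iff norm_minus_commute)
  then show ?thesis using \<open>x\<in>E\<close> \<open>y\<in>E\<close> unfolding D_def by (meson le_cases)
qed

text \<open>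
  Together with \<open>variation_sums_bounded\<close> this turns membership in \<open>BV\<close> into a uniform bound for
  finite real sums over separated segments: inside each interval of a family one picks a segment
  that realises half of the oscillation. The type of the index is \<open>real set\<close> because the
  intervals index themselves.
\<close>

lemma BV_if_variation_sums_bounded:
  assumes per: "\<And>x. f (x + P) = f x" and p: "p \<ge> 1"
    and C: "\<And>(J :: real set set) x y. separated_segments P J x y \<Longrightarrow>
           (\<Sum>j\<in>J. norm (f (y j) - f (x j)) powr p) \<le> C"
  shows "f \<in> BV p P"
proof -
  have bd: "norm (f u - f v) \<le> C powr (1/p)" if "u \<in> {0..P}" "v \<in> {0..P}" for u v
  proof -
    have "norm (f b - f a) \<le> C powr (1/p)" if "a \<le> b" "a \<in> {0..P}" "b \<in> {0..P}" for a b
    proof -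
      have "norm (f b - f a) powr p \<le> C"
        using C[of "{UNIV}" "\<lambda>_. a" "\<lambda>_. b"] that
        by (auto simp: separated_segments_def disjoint_family_on_def)
      then show ?thesis using p powr_mono2[of "1/p" "norm (f b - f a) powr p" C]
        by (simp add: powr_powr)
    qed
    from this[of u v] this[of v u] that show ?thesis by (metis le_cases norm_minus_commute)
  qed
  have osc_fin: "osc f E < top" if "E \<subseteq> {0..P}" for E
  proof -
    have "osc f E \<le> ennreal (C powr (1/p))"
      unfolding osc_def using that by (intro SUP_least ennreal_leI bd) auto
    then show ?thesis using ennreal_less_top le_less_trans by blast
  qed
  have main: "(\<Sum>E\<in>\<I>. ennpowr (osc f E) p) \<le> ennreal (2 powr p * C)" if "\<I> \<in> interval_families P" for \<I>
  proof -
    have fam: "finite \<I>" "disjoint \<I>" "\<And>E. E \<in> \<I> \<Longrightarrow> is_interval E \<and> E \<subseteq> {0..P}"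
      using that by (auto simp: interval_families_def)
    define J where "J = \<I> - {{}}"
    have "\<forall>E\<in>J. \<exists>x y. x \<in> E \<and> y \<in> E \<and> x \<le> y \<and> enn2real (osc f E) \<le> 2 * norm (f y - f x)"
    proof
      fix E assume "E \<in> J"
      then have "E \<noteq> {}" "osc f E < top" using osc_fin fam unfolding J_def by auto
      from osc_half_attained[OF this]
      show "\<exists>x y. x \<in> E \<and> y \<in> E \<and> x \<le> y \<and> enn2real (osc f E) \<le> 2 * norm (f y - f x)" by blast
    qed
    then obtain x y where xy: "\<And>E. E \<in> J \<Longrightarrow> x E \<in> E \<and> y E \<in> E \<and> x E \<le> y E \<and> enn2real (osc f E) \<le> 2 * norm (f (y E) - f (x E))"
      by metis
    have sub: "{x E..y E} \<subseteq> E" if "E \<in> J" for E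
    proof
      fix t assume "t \<in> {x E..y E}"
      moreover have "is_interval E" using fam(3) that by (simp add: J_def)
      ultimately show "t \<in> E" using xy[OF that] unfolding is_interval_1 by auto
    qed
    have "separated_segments P J x y"
      unfolding separated_segments_def disjoint_family_on_def
    proof (intro conjI ballI impI)
      show "finite J" using fam by (simp add: J_def)
    next
      fix E assume "E \<in> J"
      then show "0 \<le> x E" "x E \<le> y E" "y E \<le> P" using xy[of E] fam(3)[of E] by (auto simp: J_def)
    next
      fix E F assume "E \<in> J" "F \<in> J" "E \<noteq> F"
      moreover have "E \<inter> F = {}" using calculation fam(2) by (auto simp: J_def disjoint_def)
      ultimately show "{x E..y E} \<inter> {x F..y F} = {}" using sub by blast
    qed
    from C[OF this] have S: "(\<Sum>E\<in>J. norm (f (y E) - f (x E)) powr p) \<le> C" .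
    \<comment> \<open>An empty interval offers no endpoints, but it has oscillation 0.\<close>
    have "(\<Sum>E\<in>\<I>. ennpowr (osc f E) p) = (\<Sum>E\<in>J. ennpowr (osc f E) p)"
      unfolding J_def using fam(1) by (intro sum.mono_neutral_right) (auto simp: osc_empty ennpowr_def)
    also have "\<dots> = (\<Sum>E\<in>J. ennreal (enn2real (osc f E) powr p))"
      using osc_fin fam by (intro sum.cong) (auto simp: ennpowr_def J_def less_top)
    also have "\<dots> \<le> (\<Sum>E\<in>J. ennreal (2 powr p * norm (f (y E) - f (x E)) powr p))"
    proof (intro sum_mono ennreal_leI)
      fix E assume "E \<in> J"
      have "enn2real (osc f E) powr p \<le> (2 * norm (f (y E) - f (x E))) powr p"
        using xy[OF \<open>E \<in> J\<close>] p by (intro powr_mono2) auto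
      then show "enn2real (osc f E) powr p \<le> 2 powr p * norm (f (y E) - f (x E)) powr p"
        by (simp add: powr_mult)
    qed
    also have "\<dots> = ennreal (2 powr p * (\<Sum>E\<in>J. norm (f (y E) - f (x E)) powr p))"
      by (simp add: sum_distrib_left)
    also have "\<dots> \<le> ennreal (2 powr p * C)" using S by (intro ennreal_leI mult_left_mono) auto
    finally show ?thesis .
  qed
  have C0: "C \<ge> 0" using C[of "{}"] by (simp add: separated_segments_def disjoint_family_on_def)
  have "p_variation p f P \<le> ennreal ((2 powr p * C) powr (1/p))"
    unfolding p_variation_def
  proof (rule SUP_least)
    fix \<I> assume "\<I> \<in> interval_families P"
    from ennpowr_mono[OF _ main[OF this], of "1/p"]
    show "ennpowr (\<Sum>E\<in>\<I>. ennpowr (osc f E) p) (1 / p) \<le> ennreal ((2 powr p * C) powr (1/p))"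
      using p C0 by (simp add: ennpowr_ennreal)
  qed
  then have "p_variation p f P < top" using ennreal_less_top le_less_trans by blast
  then show ?thesis using per by (simp add: BV_def)
qed

section \<open>Mean squares of exponential sums\<close>

lemma has_integral_cis:
  "((\<lambda>x. cis (pi * real_of_int m * x)) has_integral (if m = 0 then 2 else 0)) {0..2}"
proof (cases "m = 0")
  case True
  then show ?thesis using has_integral_const_real[of "1::complex" 0 2] by (simp add: scaleR_conv_of_real)
next
  case False
  define F where "F x = cis (pi * real_of_int m * x) / (\<i> * of_real (pi * real_of_int m))" for x
  have "((\<lambda>x. cis (pi * real_of_int m * x)) has_integral (F 2 - F 0)) {0..2}"
  proof (rule fundamental_theorem_of_calculus)
    fix x :: real
    show "(F has_vector_derivative cis (pi * real_of_int m * x)) (at x within {0..2})"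
      unfolding F_def has_vector_derivative_def using False
      by (auto intro!: derivative_eq_intros simp: field_simps scaleR_conv_of_real)
  qed simp
  moreover have "cis (pi * real_of_int m * 2) = 1"
    using cis_multiple_2pi[of "real_of_int m"] by (simp add: mult_ac)
  ultimately show ?thesis using False by (simp add: F_def)
qed

text \<open>
  Parseval for exponential sums in which frequencies may coincide. Coincidences are allowed
  because the square of an exponential sum over \<open>n\<^sup>2\<close> is one over the pairs \<open>(n, m)\<close> with frequency
  \<open>n\<^sup>2 + m\<^sup>2\<close>; this is how the fourth moment is computed below.
\<close>

lemma has_integral_norm_sq_trig_sum:
  fixes c :: "'a \<Rightarrow> complex" and \<phi> :: "'a \<Rightarrow> int"
  assumes "finite A"
  shows "((\<lambda>x. (norm (\<Sum>a\<in>A. c a * cis (pi * real_of_int (\<phi> a) * x)))\<^sup>2) has_integral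
          2 * (\<Sum>(a,b)\<in>{(a,b). a \<in> A \<and> b \<in> A \<and> \<phi> a = \<phi> b}. Re (c a * cnj (c b)))) {0..2}"
proof -
  have 1: "((\<lambda>x. \<Sum>(a,b)\<in>A\<times>A. c a * cnj (c b) * cis (pi * real_of_int (\<phi> a - \<phi> b) * x)) has_integral
         (\<Sum>(a,b)\<in>A\<times>A. c a * cnj (c b) * (if \<phi> a - \<phi> b = 0 then 2 else 0))) {0..2}"
    using assms unfolding case_prod_unfold
    by (intro has_integral_sum has_integral_mult_right has_integral_cis) auto
  have 2: "(\<Sum>(a,b)\<in>A\<times>A. c a * cnj (c b) * cis (pi * real_of_int (\<phi> a - \<phi> b) * x))
     = of_real ((norm (\<Sum>a\<in>A. c a * cis (pi * real_of_int (\<phi> a) * x)))\<^sup>2)" for x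
  proof -
    have "of_real ((norm (\<Sum>a\<in>A. c a * cis (pi * real_of_int (\<phi> a) * x)))\<^sup>2)
      = (\<Sum>a\<in>A. c a * cis (pi * real_of_int (\<phi> a) * x)) * (\<Sum>b\<in>A. cnj (c b) * cis (- (pi * real_of_int (\<phi> b) * x)))"
      unfolding complex_norm_square by (simp add: cis_cnj)
    also have "\<dots> = (\<Sum>(a,b)\<in>A\<times>A. c a * cnj (c b) * (cis (pi * real_of_int (\<phi> a) * x) * cis (- (pi * real_of_int (\<phi> b) * x))))"
      unfolding sum_product sum.cartesian_product by (simp add: mult_ac)
    also have "\<dots> = (\<Sum>(a,b)\<in>A\<times>A. c a * cnj (c b) * cis (pi * real_of_int (\<phi> a - \<phi> b) * x))"
      by (simp add: cis_mult algebra_simps)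
    finally show ?thesis by simp
  qed
  have 3: "Re (\<Sum>(a,b)\<in>A\<times>A. c a * cnj (c b) * (if \<phi> a - \<phi> b = 0 then 2 else 0))
     = 2 * (\<Sum>(a,b)\<in>{(a,b). a \<in> A \<and> b \<in> A \<and> \<phi> a = \<phi> b}. Re (c a * cnj (c b)))"
    using assms unfolding Re_sum sum_distrib_left
    by (intro sum.mono_neutral_cong_right) (auto split: if_splits)
  from has_integral_linear[OF 1[unfolded 2] bounded_linear_Re] show ?thesis
    unfolding o_def 3 Re_complex_of_real .
qed

lemma integral_norm_sq_trig_sum_le:
  fixes c :: "'a \<Rightarrow> complex" and \<phi> :: "'a \<Rightarrow> int"
  assumes "finite A" "\<And>a. a \<in> A \<Longrightarrow> norm (c a) \<le> B"
  shows "integral {0..2} (\<lambda>x. (norm (\<Sum>a\<in>A. c a * cis (pi * real_of_int (\<phi> a) * x)))\<^sup>2)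
          \<le> 2 * B\<^sup>2 * real (card {(a,b). a \<in> A \<and> b \<in> A \<and> \<phi> a = \<phi> b})"
proof -
  have "(\<Sum>(a,b)\<in>{(a,b). a \<in> A \<and> b \<in> A \<and> \<phi> a = \<phi> b}. Re (c a * cnj (c b)))
      \<le> (\<Sum>(a,b)\<in>{(a,b). a \<in> A \<and> b \<in> A \<and> \<phi> a = \<phi> b}. B\<^sup>2)"
  proof (rule sum_mono, clarify)
    fix a b assume ab: "a \<in> A" "b \<in> A"
    have "Re (c a * cnj (c b)) \<le> norm (c a) * norm (c b)"
      by (metis complex_Re_le_cmod complex_mod_cnj norm_mult)
    also have "\<dots> \<le> B * B"
      using assms(2)[OF ab(1)] assms(2)[OF ab(2)] by (intro mult_mono) (auto intro: order_trans[OF norm_ge_zero])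
    finally show "Re (c a * cnj (c b)) \<le> B\<^sup>2" by (simp add: power2_eq_square)
  qed
  then show ?thesis
    using integral_unique[OF has_integral_norm_sq_trig_sum[OF assms(1), of c \<phi>]] by (simp add: mult_ac)
qed

lemma integral_norm_sq_trig_sum_inj:
  fixes c :: "'a \<Rightarrow> complex" and \<phi> :: "'a \<Rightarrow> int"
  assumes "finite A" "inj_on \<phi> A"
  shows "integral {0..2} (\<lambda>x. (norm (\<Sum>a\<in>A. c a * cis (pi * real_of_int (\<phi> a) * x)))\<^sup>2)
          = 2 * (\<Sum>a\<in>A. (norm (c a))\<^sup>2)"
proof -
  have eq: "{(a,b). a \<in> A \<and> b \<in> A \<and> \<phi> a = \<phi> b} = (\<lambda>a. (a,a)) ` A"
    using assms(2) by (auto simp: inj_on_def)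
  have "inj_on (\<lambda>a. (a,a)) A" by (auto simp: inj_on_def)
  then have "(\<Sum>(a,b)\<in>{(a,b). a \<in> A \<and> b \<in> A \<and> \<phi> a = \<phi> b}. Re (c a * cnj (c b))) = (\<Sum>a\<in>A. (norm (c a))\<^sup>2)"
    unfolding eq by (simp add: sum.reindex cmod_power2 flip: power2_eq_square)
  then show ?thesis
    using integral_unique[OF has_integral_norm_sq_trig_sum[OF assms(1), of c \<phi>]] by simp
qed

section \<open>First and second variation of smooth functions\<close>

lemma sum_integral_segments_le:
  fixes g :: "real \<Rightarrow> real"
  assumes sep: "separated_segments P J x y" and cont: "continuous_on {0..P} g" and nonneg: "\<And>t. g t \<ge> 0"
  shows "(\<Sum>j\<in>J. integral {x j..y j} g) \<le> integral {0..P} g"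
proof -
  have sub: "{x j..y j} \<subseteq> {0..P}" if "j \<in> J" for j
    using sep that by (auto simp: separated_segments_def)
  have int: "(g has_integral integral {x j..y j} g) {x j..y j}" if "j \<in> J" for j
    using continuous_on_subset[OF cont sub[OF that]] by (intro integrable_integral integrable_continuous_interval)
  have "(g has_integral (\<Sum>j\<in>J. integral {x j..y j} g)) (\<Union>j\<in>J. {x j..y j})"
  proof (rule has_integral_UN)
    show "pairwise (\<lambda>i i'. negligible ({x i..y i} \<inter> {x i'..y i'})) J"
      using sep by (auto simp: separated_segments_def disjoint_family_on_def pairwise_def)
  qed (use sep int in \<open>auto simp: separated_segments_def\<close>)
  moreover have "(g has_integral integral {0..P} g) {0..P}"
    using cont by (intro integrable_integral integrable_continuous_interval)
  moreover have "(\<Union>j\<in>J. {x j..y j}) \<subseteq> {0..P}" using sub by blast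
  ultimately show ?thesis
    by (metis (no_types, lifting) has_integral_subset_le nonneg)
qed

lemma norm_diff_le_integral_norm_deriv:
  fixes F :: "real \<Rightarrow> 'a::banach"
  assumes "a \<le> b" "\<And>t. (F has_vector_derivative F' t) (at t)" "continuous_on UNIV F'"
  shows "norm (F b - F a) \<le> integral {a..b} (\<lambda>t. norm (F' t))"
proof -
  have c: "continuous_on {a..b} F'" using assms(3) continuous_on_subset by blast
  have "(F' has_integral (F b - F a)) {a..b}"
    by (rule fundamental_theorem_of_calculus[OF assms(1) has_vector_derivative_at_within[OF assms(2)]])
  then have "F b - F a = integral {a..b} F'" by (rule integral_unique[symmetric])
  also have "norm \<dots> \<le> integral {a..b} (\<lambda>t. norm (F' t))"
    by (intro integral_norm_bound_integral integrable_continuous_interval continuous_on_norm c) simp_all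
  finally show ?thesis .
qed

lemma has_field_derivative_mult_abs: "((\<lambda>t::real. t * \<bar>t\<bar>) has_field_derivative 2 * \<bar>t\<bar>) (at t)"
proof (cases "t = 0")
  case True
  have "((\<lambda>h::real. (h * \<bar>h\<bar> - 0) / (h - 0)) \<longlongrightarrow> 0) (at 0)"
  proof (rule Lim_transform_eventually)
    show "((\<lambda>h::real. \<bar>h\<bar>) \<longlongrightarrow> 0) (at 0)" by (intro tendsto_eq_intros) auto
    show "\<forall>\<^sub>F h::real in at 0. \<bar>h\<bar> = (h * \<bar>h\<bar> - 0) / (h - 0)"
      by (auto simp: eventually_at_filter)
  qed
  then show ?thesis using True by (simp add: has_field_derivative_iff)
next
  case False
  then consider "t > 0" | "t < 0" by linarith
  then show ?thesis
  proof cases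
    case 1
    have "((\<lambda>t::real. t * t) has_field_derivative 2 * \<bar>t\<bar>) (at t)"
      using 1 by (auto intro!: derivative_eq_intros)
    then show ?thesis
      by (rule has_field_derivative_transform_within_open[of _ _ _ "{0<..}"]) (use 1 in auto)
  next
    case 2
    have "((\<lambda>t::real. - (t * t)) has_field_derivative 2 * \<bar>t\<bar>) (at t)"
      using 2 by (auto intro!: derivative_eq_intros)
    then show ?thesis
      by (rule has_field_derivative_transform_within_open[of _ _ _ "{..<0}"]) (use 2 in auto)
  qed
qed

text \<open>
  The map \<open>t \<mapsto> t * |t|\<close> is a signed square with derivative \<open>2 * |t|\<close>, and it separates points at
  least as well as half the squared distance. Composed with a function \<open>u\<close> it therefore controls
  \<open>(u b - u a)\<^sup>2\<close> by the integral of \<open>|u| * |u'|\<close> over the segment alone. That bound is additive over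
  disjoint segments; \<open>t\<^sup>2\<close> would not do, since it does not see changes of sign.
\<close>

lemma square_diff_le_signed_squares:
  fixes a b :: real
  shows "(a - b)\<^sup>2 \<le> 2 * \<bar>a * \<bar>a\<bar> - b * \<bar>b\<bar>\<bar>"
proof -
  have *: "(a - b)\<^sup>2 \<le> 2 * \<bar>a * \<bar>a\<bar> - b * \<bar>b\<bar>\<bar>" if "a \<ge> b" for a b :: real
  proof (cases "a \<ge> 0 \<and> b < 0")
    case True
    then have "(a - b)\<^sup>2 \<le> 2 * (a * a + b * b)" using sum_squares_ge_zero[of "a+b" 0] by (simp add: power2_eq_square algebra_simps)
    then show ?thesis using True by (simp add: abs_if)
  next
    case False
    with that consider "b \<ge> 0" | "a < 0" by linarith
    then show ?thesis
    proof cases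
      case 1
      have "(a - b) * (a - b) \<le> (a - b) * (2 * (a + b))" using 1 that by (intro mult_left_mono) auto
      also have "\<dots> \<le> 2 * \<bar>a * a - b * b\<bar>" by (simp add: algebra_simps abs_if)
      finally show ?thesis using 1 that by (simp add: power2_eq_square)
    next
      case 2
      have "(a - b) * (a - b) \<le> (a - b) * (2 * (- a - b))" using 2 that by (intro mult_left_mono) auto
      also have "\<dots> \<le> 2 * \<bar>b * b - a * a\<bar>" by (simp add: algebra_simps abs_if)
      finally show ?thesis using 2 that by (simp add: power2_eq_square abs_if)
    qed
  qed
  show ?thesis using *[of a b] *[of b a] by (cases "a \<ge> b") (auto simp: power2_commute abs_minus_commute)
qed

lemma square_increment_le_integral:
  fixes u :: "real \<Rightarrow> real"
  assumes "a \<le> b" and der: "\<And>t. (u has_vector_derivative u' t) (at t)" and cont: "continuous_on UNIV u'"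
  shows "(u b - u a)\<^sup>2 \<le> 4 * integral {a..b} (\<lambda>t. \<bar>u t\<bar> * \<bar>u' t\<bar>)"
proof -
  have contu: "continuous_on UNIV u"
    using der by (intro continuous_at_imp_continuous_on) (auto intro: has_vector_derivative_continuous)
  have "norm (u b * \<bar>u b\<bar> - u a * \<bar>u a\<bar>) \<le> integral {a..b} (\<lambda>t. norm (2 * \<bar>u t\<bar> * u' t))"
  proof (rule norm_diff_le_integral_norm_deriv[OF \<open>a \<le> b\<close>])
    fix t
    show "((\<lambda>t. u t * \<bar>u t\<bar>) has_vector_derivative 2 * \<bar>u t\<bar> * u' t) (at t)"
      using DERIV_chain2[OF has_field_derivative_mult_abs der[of t, folded has_real_derivative_iff_has_vector_derivative]]
      unfolding has_real_derivative_iff_has_vector_derivative .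
  qed (intro continuous_intros contu cont)
  also have "\<dots> = 2 * integral {a..b} (\<lambda>t. \<bar>u t\<bar> * \<bar>u' t\<bar>)"
    by (simp add: abs_mult mult.assoc)
  finally show ?thesis using square_diff_le_signed_squares[of "u b" "u a"] by simp
qed

lemma sum_norm_increments_le:
  fixes f :: "real \<Rightarrow> complex"
  assumes sep: "separated_segments P J x y"
    and der: "\<And>t. (f has_vector_derivative f' t) (at t)" and cont: "continuous_on UNIV f'"
  shows "(\<Sum>j\<in>J. norm (f (y j) - f (x j))) \<le> integral {0..P} (\<lambda>t. norm (f' t))"
proof -
  have "(\<Sum>j\<in>J. norm (f (y j) - f (x j))) \<le> (\<Sum>j\<in>J. integral {x j..y j} (\<lambda>t. norm (f' t)))"
    using sep by (intro sum_mono norm_diff_le_integral_norm_deriv der cont) (auto simp: separated_segments_def)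
  also have "\<dots> \<le> integral {0..P} (\<lambda>t. norm (f' t))"
    by (intro sum_integral_segments_le sep continuous_intros continuous_on_subset[OF cont]) auto
  finally show ?thesis .
qed

text \<open>
  The analogue for the 2-variation of the bound of the 1-variation by the integral of \<open>|f'|\<close>.
  It follows from the real case applied to the real and the imaginary part.
\<close>

lemma sum_square_increments_le:
  fixes f :: "real \<Rightarrow> complex"
  assumes sep: "separated_segments P J x y"
    and der: "\<And>t. (f has_vector_derivative f' t) (at t)" and cont: "continuous_on UNIV f'"
  shows "(\<Sum>j\<in>J. (norm (f (y j) - f (x j)))\<^sup>2) \<le> 8 * integral {0..P} (\<lambda>t. norm (f t) * norm (f' t))"
proof -
  have contf: "continuous_on UNIV f"
    using der by (intro continuous_at_imp_continuous_on) (auto intro: has_vector_derivative_continuous)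
  have real_part: "(\<Sum>j\<in>J. (u (y j) - u (x j))\<^sup>2) \<le> 4 * integral {0..P} (\<lambda>t. norm (f t) * norm (f' t))"
    if u: "\<And>t. (u has_vector_derivative u' t) (at t)" "continuous_on UNIV u'"
      "\<And>t. \<bar>u t\<bar> \<le> norm (f t)" "\<And>t. \<bar>u' t\<bar> \<le> norm (f' t)" for u u' :: "real \<Rightarrow> real"
  proof -
    have contu: "continuous_on UNIV u"
      using u(1) by (intro continuous_at_imp_continuous_on) (auto intro: has_vector_derivative_continuous)
    have "(\<Sum>j\<in>J. (u (y j) - u (x j))\<^sup>2) \<le> (\<Sum>j\<in>J. 4 * integral {x j..y j} (\<lambda>t. \<bar>u t\<bar> * \<bar>u' t\<bar>))"
      using sep by (intro sum_mono square_increment_le_integral u) (auto simp: separated_segments_def)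
    also have "\<dots> = 4 * (\<Sum>j\<in>J. integral {x j..y j} (\<lambda>t. \<bar>u t\<bar> * \<bar>u' t\<bar>))"
      by (simp add: sum_distrib_left)
    also have "\<dots> \<le> 4 * integral {0..P} (\<lambda>t. \<bar>u t\<bar> * \<bar>u' t\<bar>)"
      by (intro mult_left_mono sum_integral_segments_le sep continuous_intros
          continuous_on_subset[OF contu] continuous_on_subset[OF u(2)]) auto
    also have "\<dots> \<le> 4 * integral {0..P} (\<lambda>t. norm (f t) * norm (f' t))"
      by (intro mult_left_mono integral_le integrable_continuous_interval continuous_intros mult_mono u
          continuous_on_subset[OF contu] continuous_on_subset[OF u(2)]
          continuous_on_subset[OF contf] continuous_on_subset[OF cont]) auto
    finally show ?thesis .
  qed
  have "(\<Sum>j\<in>J. (Re (f (y j)) - Re (f (x j)))\<^sup>2) \<le> 4 * integral {0..P} (\<lambda>t. norm (f t) * norm (f' t))"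
    by (rule real_part[of _ "\<lambda>t. Re (f' t)"])
       (auto intro!: continuous_intros cont abs_Re_le_cmod bounded_linear.has_vector_derivative[OF bounded_linear_Re] der)
  moreover have "(\<Sum>j\<in>J. (Im (f (y j)) - Im (f (x j)))\<^sup>2) \<le> 4 * integral {0..P} (\<lambda>t. norm (f t) * norm (f' t))"
    by (rule real_part[of _ "\<lambda>t. Im (f' t)"])
       (auto intro!: continuous_intros cont abs_Im_le_cmod bounded_linear.has_vector_derivative[OF bounded_linear_Im] der)
  ultimately show ?thesis by (simp add: cmod_power2 sum.distrib)
qed

section \<open>Riemann's function as a lacunary Fourier series\<close>

definition riemann_term :: "nat \<Rightarrow> real \<Rightarrow> complex" where
  "riemann_term n x = cis (pi * real_of_int (int (n\<^sup>2)) * x) / (of_real pi * \<i> * of_nat n ^ 2)"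

lemma norm_riemann_term: "norm (riemann_term n x) = 1 / (pi * real n ^ 2)"
  by (simp add: riemann_term_def norm_divide norm_mult norm_power)

lemma summable_riemann_term: "summable (\<lambda>k. riemann_term (Suc k) x)"
proof (rule summable_comparison_test')
  show "summable (\<lambda>k. 1 / real (Suc k) ^ 2)"
    using summable_Suc_iff[of "\<lambda>n. 1 / real n ^ 2"] inverse_power_summable[of 2, where 'a=real]
    by (simp add: field_simps)
  fix k :: nat
  have "1 / (pi * real (Suc k) ^ 2) \<le> 1 / (1 * real (Suc k) ^ 2)"
    using pi_gt3 by (intro divide_left_mono mult_right_mono) auto
  then show "norm (riemann_term (Suc k) x) \<le> 1 / real (Suc k) ^ 2"
    by (simp add: norm_riemann_term)
qed

lemma Phi_eq_suminf: "Phi x = (\<Sum>k. riemann_term (Suc k) x)"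
  unfolding Phi_def riemann_term_def cis_conv_exp
  by (intro suminf_cong arg_cong2[of _ _ _ _ "(/)"] arg_cong[of _ _ exp] refl) (simp add: mult_ac)

lemma Phi_sums: "(\<lambda>k. riemann_term (Suc k) x) sums Phi x"
  unfolding Phi_eq_suminf using summable_riemann_term by (rule summable_sums)

lemma Phi_periodic: "Phi (x + 2) = Phi x"
proof -
  have "riemann_term n (x + 2) = riemann_term n x" for n
  proof -
    have "cis (pi * real_of_int (int (n\<^sup>2)) * (x + 2))
        = cis (pi * real_of_int (int (n\<^sup>2)) * x) * cis (2 * pi * real_of_int (int (n\<^sup>2)))"
      by (simp add: cis_mult algebra_simps)
    also have "cis (2 * pi * real_of_int (int (n\<^sup>2))) = 1"
      by (intro cis_multiple_2pi) simp
    finally show ?thesis by (simp add: riemann_term_def)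
  qed
  then show ?thesis by (simp add: Phi_eq_suminf)
qed

lemma riemann_term_has_vector_derivative:
  assumes "n > 0"
  shows "(riemann_term n has_vector_derivative cis (pi * real_of_int (int (n\<^sup>2)) * x)) (at x)"
  using assms unfolding riemann_term_def[abs_def] has_vector_derivative_def
  by (auto intro!: derivative_eq_intros simp: field_simps scaleR_conv_of_real)

lemma inj_on_int_square: "inj_on (\<lambda>n::nat. int (n\<^sup>2)) A"
  by (auto simp: inj_on_def)

section \<open>Finite variation above the critical exponent\<close>

definition dyadic_block :: "nat \<Rightarrow> real \<Rightarrow> complex" where
  "dyadic_block N x = (\<Sum>n\<in>{N..<2*N}. riemann_term n x)"

definition dyadic_block' :: "nat \<Rightarrow> real \<Rightarrow> complex" where
  "dyadic_block' N x = (\<Sum>n\<in>{N..<2*N}. cis (pi * real_of_int (int (n\<^sup>2)) * x))"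

context
  fixes N :: nat
  assumes N: "N > 0"
begin

lemma dyadic_block_has_vector_derivative:
  "(dyadic_block N has_vector_derivative dyadic_block' N x) (at x)"
  unfolding dyadic_block_def[abs_def] dyadic_block'_def using N
  by (intro has_vector_derivative_sum riemann_term_has_vector_derivative) auto

lemma continuous_on_dyadic_block': "continuous_on A (dyadic_block' N)"
  unfolding dyadic_block'_def[abs_def] by (intro continuous_intros)

lemma continuous_on_dyadic_block: "continuous_on A (dyadic_block N)"
  using dyadic_block_has_vector_derivative
  by (intro continuous_at_imp_continuous_on) (auto intro: has_vector_derivative_continuous)

lemma integral_norm_sq_dyadic_block': "integral {0..2} (\<lambda>x. (norm (dyadic_block' N x))\<^sup>2) = 2 * real N"
  using integral_norm_sq_trig_sum_inj[OF _ inj_on_int_square, of "{N..<2*N}" "\<lambda>_. 1"]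
  by (simp add: dyadic_block'_def)

lemma integral_norm_sq_dyadic_block:
  "integral {0..2} (\<lambda>x. (norm (dyadic_block N x))\<^sup>2) \<le> 2 / real N ^ 3"
proof -
  have "integral {0..2} (\<lambda>x. (norm (dyadic_block N x))\<^sup>2)
      = 2 * (\<Sum>n\<in>{N..<2*N}. (norm (1 / (of_real pi * \<i> * of_nat n ^ 2)))\<^sup>2)"
    using integral_norm_sq_trig_sum_inj[OF _ inj_on_int_square, of "{N..<2*N}" "\<lambda>n. 1 / (of_real pi * \<i> * of_nat n ^ 2)"]
    by (simp add: dyadic_block_def riemann_term_def)
  also have "\<dots> \<le> 2 * (\<Sum>n\<in>{N..<2*N}. (1 / real N ^ 2)\<^sup>2)"
  proof (intro mult_left_mono sum_mono power_mono)
    fix n assume n: "n \<in> {N..<2*N}"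
    have "1 * real N ^ 2 \<le> pi * real n ^ 2"
      using n pi_gt3 by (intro mult_mono power_mono) auto
    then show "norm (1 / (of_real pi * \<i> * of_nat n ^ 2)) \<le> 1 / real N ^ 2"
      using N n by (simp add: norm_divide norm_mult norm_power frac_le)
  qed auto
  also have "\<dots> = 2 / real N ^ 3"
    using N by (simp add: field_simps power_numeral_reduce)
  finally show ?thesis .
qed

lemma sum_increments_dyadic_block_le:
  assumes "separated_segments 2 J x y"
  shows "(\<Sum>j\<in>J. norm (dyadic_block N (y j) - dyadic_block N (x j))) \<le> 2 * sqrt (real N)"
proof -
  have "(\<Sum>j\<in>J. norm (dyadic_block N (y j) - dyadic_block N (x j))) \<le> integral {0..2} (\<lambda>x. norm (dyadic_block' N x))"
    by (rule sum_norm_increments_le[OF assms dyadic_block_has_vector_derivative continuous_on_dyadic_block'])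
  also have "\<dots> \<le> integral {0..2} (\<lambda>x. sqrt (real N) / 2 + 1 / (2 * sqrt (real N)) * (norm (dyadic_block' N x))\<^sup>2)"
  proof (intro integral_le integrable_continuous_interval continuous_intros continuous_on_dyadic_block')
    fix x :: real
    define u where "u = norm (dyadic_block' N x)"
    \<comment> \<open>By Parseval the root mean square of the derivative is sqrt N, so comparing u with sqrt N loses nothing.\<close>
    have "0 \<le> (u - sqrt (real N))\<^sup>2" by simp
    then have "2 * sqrt (real N) * u \<le> real N + u\<^sup>2" by (simp add: power2_diff mult_ac)
    then have "u \<le> (real N + u\<^sup>2) / (2 * sqrt (real N))" using N by (simp add: field_simps)
    also have "\<dots> = sqrt (real N) / 2 + 1 / (2 * sqrt (real N)) * u\<^sup>2"
      using N by (simp add: add_divide_distrib real_div_sqrt flip: divide_divide_eq_left) 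
    finally show "u \<le> sqrt (real N) / 2 + 1 / (2 * sqrt (real N)) * u\<^sup>2" .
  qed
  also have "\<dots> = sqrt (real N) + 1 / (2 * sqrt (real N)) * (2 * real N)"
    by (subst integral_add) (auto intro!: integrable_continuous_interval continuous_intros continuous_on_dyadic_block'
        simp: N integral_norm_sq_dyadic_block' simp del: of_nat_mult)
  also have "\<dots> = 2 * sqrt (real N)" using N by (simp add: real_div_sqrt)
  finally show ?thesis .
qed

lemma sum_square_increments_dyadic_block_le:
  assumes "separated_segments 2 J x y"
  shows "(\<Sum>j\<in>J. (norm (dyadic_block N (y j) - dyadic_block N (x j)))\<^sup>2) \<le> 16 / real N"
proof -
  note cont = continuous_on_dyadic_block' continuous_on_dyadic_block
  let ?f = "\<lambda>x. norm (dyadic_block N x)" and ?g = "\<lambda>x. norm (dyadic_block' N x)"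
  have "(\<Sum>j\<in>J. (norm (dyadic_block N (y j) - dyadic_block N (x j)))\<^sup>2) \<le> 8 * integral {0..2} (\<lambda>x. ?f x * ?g x)"
    by (rule sum_square_increments_le[OF assms dyadic_block_has_vector_derivative continuous_on_dyadic_block'])
  also have "integral {0..2} (\<lambda>x. ?f x * ?g x)
     \<le> integral {0..2} (\<lambda>x. real N ^ 2 / 2 * (?f x)\<^sup>2 + 1 / (2 * real N ^ 2) * (?g x)\<^sup>2)"
  proof (intro integral_le integrable_continuous_interval continuous_intros cont)
    fix x :: real
    define u v where "u = ?f x" and "v = ?g x"
    \<comment> \<open>The mean squares of u and v are 1 / N^3 and N up to constants, so this weight balances the two terms.\<close>
    have "0 \<le> (real N * u - v / real N)\<^sup>2" by simp
    then have "2 * (u * v) \<le> real N ^ 2 * u\<^sup>2 + v\<^sup>2 / real N ^ 2"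
      using N by (simp add: power2_diff power_mult_distrib power_divide)
    then show "u * v \<le> real N ^ 2 / 2 * u\<^sup>2 + 1 / (2 * real N ^ 2) * v\<^sup>2" by simp
  qed
  also have "\<dots> = real N ^ 2 / 2 * integral {0..2} (\<lambda>x. (?f x)\<^sup>2) + 1 / (2 * real N ^ 2) * (2 * real N)"
    by (subst integral_add) (auto intro!: integrable_continuous_interval continuous_intros cont
        simp: N integral_norm_sq_dyadic_block' simp del: of_nat_mult)
  also have "\<dots> \<le> real N ^ 2 / 2 * (2 / real N ^ 3) + 1 / (2 * real N ^ 2) * (2 * real N)"
    by (intro add_right_mono mult_left_mono integral_norm_sq_dyadic_block) auto
  also have "\<dots> = 2 / real N" using N by (simp add: field_simps power_numeral_reduce)
  finally show ?thesis by simp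
qed

end

text \<open>
  For \<open>a \<le> t\<close> the first summand dominates, for \<open>a \<ge> t\<close> the second one. Summed over \<open>a\<close> this
  interpolates between \<open>l\<^sup>1\<close> and \<open>l\<^sup>2\<close> without Hoelder's inequality.
\<close>

lemma powr_le_interpolation:
  fixes a t q :: real
  assumes "a \<ge> 0" "t > 0" "1 \<le> q" "q \<le> 2"
  shows "a powr q \<le> t powr (q - 1) * a + t powr (q - 2) * a\<^sup>2"
proof (cases "a = 0")
  case False
  then have a: "a > 0" using assms by simp
  show ?thesis
  proof (cases "a \<le> t")
    case True
    have "a powr q = a powr (q - 1) * a" using a by (simp add: powr_diff)
    also have "\<dots> \<le> t powr (q - 1) * a" using True assms by (intro mult_right_mono powr_mono2) auto
    finally show ?thesis by (simp add: add_increasing2)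
  next
    case False
    have "a powr q = a powr (q - 2) * a\<^sup>2" using a by (simp add: powr_diff)
    also have "\<dots> \<le> t powr (q - 2) * a\<^sup>2" using False assms by (intro mult_right_mono powr_mono2') auto
    finally show ?thesis using assms by (simp add: add_increasing)
  qed
qed (use assms in auto)

lemma sum_powr_increments_dyadic_block_le:
  assumes N: "N > 0" and q: "1 \<le> q" "q \<le> 2" and sep: "separated_segments 2 J x y"
  shows "(\<Sum>j\<in>J. norm (dyadic_block N (y j) - dyadic_block N (x j)) powr q) \<le> 18 * real N powr (2 - 3 * q / 2)"
proof -
  \<comment> \<open>The typical size of an increment of the block; with it both summands have the same order.\<close>
  define t where "t = real N powr (-3/2)"
  have t: "t > 0" using N by (simp add: t_def)
  let ?a = "\<lambda>j. norm (dyadic_block N (y j) - dyadic_block N (x j))"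
  have "(\<Sum>j\<in>J. ?a j powr q) \<le> (\<Sum>j\<in>J. t powr (q - 1) * ?a j + t powr (q - 2) * (?a j)\<^sup>2)"
    using t q by (intro sum_mono powr_le_interpolation) auto
  also have "\<dots> = t powr (q - 1) * (\<Sum>j\<in>J. ?a j) + t powr (q - 2) * (\<Sum>j\<in>J. (?a j)\<^sup>2)"
    by (simp add: sum.distrib sum_distrib_left)
  also have "\<dots> \<le> t powr (q - 1) * (2 * sqrt (real N)) + t powr (q - 2) * (16 / real N)"
    by (intro add_mono mult_left_mono sum_increments_dyadic_block_le sum_square_increments_dyadic_block_le N sep) auto
  also have "t powr (q - 1) * (2 * sqrt (real N)) = 2 * real N powr (2 - 3 * q / 2)"
  proof -
    have "t powr (q - 1) * sqrt (real N) = real N powr (-3/2 * (q - 1) + 1/2)"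
      using N unfolding t_def powr_powr powr_add by (simp add: powr_half_sqrt)
    also have "-3/2 * (q - 1) + 1/2 = 2 - 3 * q / 2" by (simp add: field_simps)
    finally show ?thesis by (simp add: mult_ac)
  qed
  also have "t powr (q - 2) * (16 / real N) = 16 * real N powr (2 - 3 * q / 2)"
  proof -
    have "t powr (q - 2) * (1 / real N) = real N powr (-3/2 * (q - 2) + (-1))"
      using N unfolding t_def powr_powr powr_add by (simp add: powr_minus field_simps)
    also have "-3/2 * (q - 2) + (-1) = 2 - 3 * q / 2" by (simp add: field_simps)
    finally show ?thesis by (simp add: mult_ac)
  qed
  finally show ?thesis by simp
qed

text \<open>
  A substitute for Minkowski's inequality when the summands decay geometrically: \<open>b j\<close> is at most
  \<open>w ^ j\<close> times the \<open>l\<^sup>q\<close> norm of the sequence \<open>b j / w ^ j\<close>, and \<open>w ^ j\<close> is summable.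
\<close>

lemma sum_powr_le_weighted:
  fixes b :: "nat \<Rightarrow> real"
  assumes w: "0 < w" "w < 1" and q: "q > 0" and b: "\<And>j. b j \<ge> 0"
  shows "(\<Sum>j<n. b j) powr q \<le> (1 / (1 - w)) powr q * (\<Sum>j<n. b j powr q / (w powr q) ^ j)"
proof -
  define m where "m = (\<Sum>j<n. b j powr q / (w powr q) ^ j) powr (1 / q)"
  have le: "b j \<le> w ^ j * m" if "j < n" for j
  proof -
    have "(b j / w ^ j) powr q = b j powr q / (w powr q) ^ j"
      using w b by (simp add: powr_divide powr_powr mult.commute flip: powr_realpow)
    also have "\<dots> \<le> (\<Sum>j<n. b j powr q / (w powr q) ^ j)"
      using that by (intro member_le_sum) auto
    finally have "((b j / w ^ j) powr q) powr (1/q) \<le> m"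
      unfolding m_def using q by (intro powr_mono2) auto
    then have "b j / w ^ j \<le> m" using q w b[of j] by (simp add: powr_powr)
    then show ?thesis using w by (simp add: field_simps)
  qed
  have m0: "m \<ge> 0" by (simp add: m_def)
  have "(\<Sum>j<n. b j) \<le> (\<Sum>j<n. w ^ j) * m"
    unfolding sum_distrib_right using le by (intro sum_mono) auto
  also have "(\<Sum>j<n. w ^ j) \<le> 1 / (1 - w)"
    using w by (simp add: sum_gp_strict divide_right_mono)
  finally have "(\<Sum>j<n. b j) \<le> 1 / (1 - w) * m" using m0 by (simp add: mult_right_mono)
  then have "(\<Sum>j<n. b j) powr q \<le> (1 / (1 - w) * m) powr q"
    using q b by (intro powr_mono2 sum_nonneg) auto
  also have "\<dots> = (1 / (1 - w)) powr q * m powr q" by (rule powr_mult)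
  also have "m powr q = (\<Sum>j<n. b j powr q / (w powr q) ^ j)"
    unfolding m_def using q by (simp add: powr_powr sum_nonneg)
  finally show ?thesis .
qed

text \<open>
  Only the partial sums of length \<open>2 ^ n - 1\<close> are unions of blocks; the summation index \<open>k\<close>
  stands for the term \<open>n = Suc k\<close> of the series.
\<close>

lemma sum_dyadic_blocks: "(\<Sum>j<n. dyadic_block (2 ^ j) x) = (\<Sum>k<2 ^ n - 1. riemann_term (Suc k) x)"
proof (induction n)
  case (Suc n)
  have "(\<Sum>k<2 ^ Suc n - 1. riemann_term (Suc k) x)
      = (\<Sum>k<2 ^ n - 1. riemann_term (Suc k) x) + (\<Sum>k\<in>{2 ^ n - 1..<2 ^ Suc n - 1}. riemann_term (Suc k) x)"
    by (simp add: lessThan_atLeast0 sum.atLeastLessThan_concat)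
  also have "(\<Sum>k\<in>{2 ^ n - 1..<2 ^ Suc n - 1}. riemann_term (Suc k) x) = dyadic_block (2 ^ n) x"
    unfolding dyadic_block_def using sum.shift_bounds_Suc_ivl[of "\<lambda>n. riemann_term n x" "2 ^ n - 1" "2 ^ Suc n - 1"]
    by simp
  finally show ?case using Suc by simp
qed simp

lemma variation_sums_Phi_bounded:
  assumes q: "4 / 3 < q" "q \<le> 2"
  shows "\<exists>C. \<forall>(J :: 'a set) x y. separated_segments 2 J x y \<longrightarrow>
           (\<Sum>j\<in>J. norm (Phi (y j) - Phi (x j)) powr q) \<le> C"
proof -
  define s where "s = (2::real) powr (2 - 3 * q / 2)"
  have s: "0 < s" "s < 1" using q powr_less_mono[of "2 - 3 * q / 2" 0 2] by (auto simp: s_def)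
  \<comment> \<open>The sums over the i-th block decay like s^i. Half of this decay pays for the weights w^i.\<close>
  define w where "w = s powr (1 / (2 * q))"
  have w: "0 < w" "w < 1" using s q powr_less_mono2[of "1 / (2 * q)" s 1] by (auto simp: w_def)
  have wq: "w powr q = sqrt s" using s q by (simp add: w_def powr_powr powr_half_sqrt)
  define C where "C = (1 / (1 - w)) powr q * (18 / (1 - sqrt s))"
  show ?thesis
  proof (intro exI[of _ C] allI impI)
    fix J :: "'a set" and x y
    assume sep: "separated_segments 2 J x y"
    define S where "S n z = (\<Sum>k<n. riemann_term (Suc k) z)" for n z
    have part: "(\<Sum>j\<in>J. norm (S (2 ^ n - 1) (y j) - S (2 ^ n - 1) (x j)) powr q) \<le> C" for n
    proof -
      let ?b = "\<lambda>i j. norm (dyadic_block (2 ^ i) (y j) - dyadic_block (2 ^ i) (x j))"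
      have "(\<Sum>j\<in>J. norm (S (2 ^ n - 1) (y j) - S (2 ^ n - 1) (x j)) powr q)
          \<le> (\<Sum>j\<in>J. (1 / (1 - w)) powr q * (\<Sum>i<n. ?b i j powr q / (w powr q) ^ i))"
      proof (rule sum_mono)
        fix j
        have "S (2 ^ n - 1) (y j) - S (2 ^ n - 1) (x j) = (\<Sum>i<n. dyadic_block (2 ^ i) (y j) - dyadic_block (2 ^ i) (x j))"
          by (simp only: S_def flip: sum_dyadic_blocks sum_subtractf)
        then have "norm (S (2 ^ n - 1) (y j) - S (2 ^ n - 1) (x j)) powr q \<le> (\<Sum>i<n. ?b i j) powr q"
          using q by (intro powr_mono2) (auto intro: norm_sum)
        also have "\<dots> \<le> (1 / (1 - w)) powr q * (\<Sum>i<n. ?b i j powr q / (w powr q) ^ i)"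
          using w q by (intro sum_powr_le_weighted) auto
        finally show "norm (S (2 ^ n - 1) (y j) - S (2 ^ n - 1) (x j)) powr q
          \<le> (1 / (1 - w)) powr q * (\<Sum>i<n. ?b i j powr q / (w powr q) ^ i)" .
      qed
      also have "\<dots> = (1 / (1 - w)) powr q * (\<Sum>i<n. (\<Sum>j\<in>J. ?b i j powr q) / (sqrt s) ^ i)"
        unfolding wq sum_divide_distrib by (subst sum.swap) (simp add: sum_distrib_left)
      also have "\<dots> \<le> (1 / (1 - w)) powr q * (\<Sum>i<n. 18 * (sqrt s) ^ i)"
      proof (intro mult_left_mono sum_mono)
        fix i
        have "(\<Sum>j\<in>J. ?b i j powr q) \<le> 18 * real (2 ^ i) powr (2 - 3 * q / 2)"
          using q sep by (intro sum_powr_increments_dyadic_block_le) auto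
        also have "real (2 ^ i) powr (2 - 3 * q / 2) = s ^ i"
          by (simp add: s_def powr_powr powr_power flip: powr_realpow) (simp add: mult.commute)
        also have "s ^ i = sqrt s ^ i * sqrt s ^ i" using s by (simp flip: power_mult_distrib)
        finally show "(\<Sum>j\<in>J. ?b i j powr q) / (sqrt s) ^ i \<le> 18 * sqrt s ^ i"
          using s by (simp add: field_simps)
      qed auto
      also have "(\<Sum>i<n. 18 * (sqrt s) ^ i) \<le> 18 / (1 - sqrt s)"
        using s by (simp add: sum_gp_strict divide_right_mono flip: sum_distrib_left)
      finally show ?thesis by (simp add: C_def mult_left_mono)
    qed
    have lim: "(\<lambda>n. S (2 ^ n - 1) z) \<longlonglongrightarrow> Phi z" for z
    proof -
      have "strict_mono (\<lambda>n. 2 ^ n - 1 :: nat)"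
      proof (rule strict_monoI_Suc)
        fix n :: nat
        have "(2::nat) ^ n \<ge> 1" by simp
        then show "2 ^ n - 1 < (2 ^ Suc n - 1 :: nat)" unfolding power_Suc by linarith
      qed
      then show ?thesis
        using LIMSEQ_subseq_LIMSEQ[OF Phi_sums[of z, unfolded sums_def]] by (simp add: S_def o_def)
    qed
    have "(\<lambda>n. \<Sum>j\<in>J. norm (S (2 ^ n - 1) (y j) - S (2 ^ n - 1) (x j)) powr q)
        \<longlonglongrightarrow> (\<Sum>j\<in>J. norm (Phi (y j) - Phi (x j)) powr q)"
      using q by (intro tendsto_sum tendsto_powr' tendsto_intros lim) auto
    then show "(\<Sum>j\<in>J. norm (Phi (y j) - Phi (x j)) powr q) \<le> C"
      by (rule LIMSEQ_le_const2) (use part in blast)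
  qed
qed

text \<open>
  The block estimates need an exponent at most 2. For larger \<open>p\<close> one uses the exponent 2, since the
  individual increments are bounded.
\<close>

lemma Phi_in_BV:
  assumes "4 / 3 < p"
  shows "Phi \<in> BV p 2"
proof -
  define q where "q = min p 2"
  have q: "4 / 3 < q" "q \<le> 2" "q \<le> p" using assms by (auto simp: q_def)
  from variation_sums_Phi_bounded[OF q(1,2), where 'a = "real set"] obtain C
    where C: "\<And>(J :: real set set) x y. separated_segments 2 J x y \<Longrightarrow>
           (\<Sum>j\<in>J. norm (Phi (y j) - Phi (x j)) powr q) \<le> C" by blast
  show ?thesis
  proof (rule BV_if_variation_sums_bounded[where f = Phi and P = 2, OF Phi_periodic])
    fix J :: "real set set" and x y
    assume sep: "separated_segments 2 J x y"
    let ?a = "\<lambda>j. norm (Phi (y j) - Phi (x j))"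
    have "?a j powr p \<le> (C powr (1/q)) powr (p - q) * ?a j powr q" if "j \<in> J" for j
    proof -
      have "?a j powr q \<le> (\<Sum>j\<in>J. ?a j powr q)"
        using sep that by (intro member_le_sum) (auto simp: separated_segments_def)
      also have "\<dots> \<le> C" by (rule C[OF sep])
      finally have "(?a j powr q) powr (1/q) \<le> C powr (1/q)" using q by (intro powr_mono2) auto
      then have le: "?a j \<le> C powr (1/q)" using q by (simp add: powr_powr)
      have "?a j powr p = ?a j powr (p - q) * ?a j powr q" by (simp flip: powr_add)
      also have "\<dots> \<le> (C powr (1/q)) powr (p - q) * ?a j powr q"
        using le q by (intro mult_right_mono powr_mono2) auto
      finally show ?thesis .
    qed
    then have "(\<Sum>j\<in>J. ?a j powr p) \<le> (C powr (1/q)) powr (p - q) * (\<Sum>j\<in>J. ?a j powr q)"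
      unfolding sum_distrib_left by (rule sum_mono)
    also have "\<dots> \<le> (C powr (1/q)) powr (p - q) * C"
      by (intro mult_left_mono C sep) auto
    finally show "(\<Sum>j\<in>J. ?a j powr p) \<le> (C powr (1/q)) powr (p - q) * C" .
  qed (use assms in auto)
qed

section \<open>Equal sums of two squares and the fourth moment\<close>

text \<open>
  A solution of \<open>A * B = C * D\<close> has the form \<open>A = g * a\<close>, \<open>C = g * c\<close>, \<open>B = c * t\<close>, \<open>D = a * t\<close> with
  \<open>g = gcd A C\<close>. For given \<open>g\<close> and \<open>t\<close> both \<open>a\<close> and \<open>c\<close> are at most \<open>X / max g t\<close>, and
  \<open>(max g t)\<^sup>2 \<ge> g * t\<close> lets the sum over \<open>g\<close> and \<open>t\<close> factor into harmonic sums.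
\<close>

lemma card_equal_products_le:
  "real (card {(A,B,C,D). A \<in> {1..X} \<and> B \<in> {1..X} \<and> C \<in> {1..X} \<and> D \<in> {1..X} \<and> A * B = C * (D::nat)})
     \<le> (real X * harm X)\<^sup>2"
proof -
  let ?M = "{(A,B,C,D). A \<in> {1..X} \<and> B \<in> {1..X} \<and> C \<in> {1..X} \<and> D \<in> {1..X} \<and> A * B = C * (D::nat)}"
  define S where "S = (SIGMA (g,t):{1..X}\<times>{1..X}. {1..X div max g t}\<times>{1..X div max g t})"
  define F where "F = (\<lambda>((g,t),(a,c)). (g * a, c * t, g * c, a * (t::nat)))"
  have "?M \<subseteq> F ` S"
  proof clarify
    fix A B C D :: nat
    assume mem: "A \<in> {1..X}" "B \<in> {1..X}" "C \<in> {1..X}" "D \<in> {1..X}" and eq: "A * B = C * D"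
    define g where "g = gcd A C"
    have g: "g > 0" using mem by (simp add: g_def)
    obtain a c where ac: "A = g * a" "C = g * c" "coprime a c"
      using gcd_coprime_exists[of A C] g unfolding g_def by (metis mult.commute less_numeral_extra(3))
    have pos: "a > 0" "c > 0" using ac mem by (auto intro!: gr0I)
    have "a * B = c * D" using eq g ac by simp
    then have "a dvd D" using ac(3) by (metis coprime_dvd_mult_right_iff dvd_triv_left)
    then obtain t where D: "D = a * t" by blast
    then have B: "B = c * t" using \<open>a * B = c * D\<close> pos by simp
    have t: "t > 0" using D mem by (auto intro!: gr0I)
    have le: "g * a \<le> X" "g * c \<le> X" "t * a \<le> X" "t * c \<le> X"
      using mem ac D B by (auto simp: mult.commute)
    have "g \<le> X" "t \<le> X" using le(1,3) pos(1) by (metis One_nat_def Suc_leI le_trans mult.right_neutral mult_le_mono2)+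
    moreover have "a \<le> X div max g t" "c \<le> X div max g t"
      using le g t by (auto simp: max_def less_eq_div_iff_mult_less_eq mult.commute)
    ultimately have "((g,t),(a,c)) \<in> S" using g t pos by (auto simp: S_def)
    moreover have "F ((g,t),(a,c)) = (A,B,C,D)" using ac D B by (simp add: F_def)
    ultimately show "(A,B,C,D) \<in> F ` S" by (metis image_eqI)
  qed
  moreover have finS: "finite S" by (auto simp: S_def)
  ultimately have "card ?M \<le> card S" by (meson surj_card_le)
  also have "card S = (\<Sum>(g,t)\<in>{1..X}\<times>{1..X}. (X div max g t)\<^sup>2)"
    by (auto simp: S_def case_prod_unfold power2_eq_square)
  finally have "real (card ?M) \<le> (\<Sum>(g,t)\<in>{1..X}\<times>{1..X}. (real (X div max g t))\<^sup>2)"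
    by (simp add: case_prod_unfold flip: of_nat_power of_nat_sum)
  also have "\<dots> \<le> (\<Sum>(g,t)\<in>{1..X}\<times>{1..X}. real X ^ 2 * (inverse (real g) * inverse (real t)))"
  proof (rule sum_mono, clarify)
    fix g t assume "g \<in> {1..X}" "t \<in> {1..X}"
    then have pos: "g > 0" "t > 0" by auto
    have "real (X div max g t) \<le> real X / real (max g t)" by (rule of_nat_div_le_of_nat)
    then have "(real (X div max g t))\<^sup>2 \<le> (real X / real (max g t))\<^sup>2" by (intro power_mono) auto
    also have "\<dots> = real X ^ 2 / (real (max g t) * real (max g t))" by (simp add: power_divide power2_eq_square)
    also have "\<dots> \<le> real X ^ 2 / (real g * real t)"
      using pos by (intro divide_left_mono mult_mono) (auto simp: max_def)
    finally show "(real (X div max g t))\<^sup>2 \<le> real X ^ 2 * (inverse (real g) * inverse (real t))" by (simp add: divide_inverse)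
  qed
  also have "\<dots> = real X ^ 2 * (harm X * harm X)"
    unfolding harm_def sum_product sum.cartesian_product by (simp only: sum_distrib_left case_prod_unfold)
  finally show ?thesis by (simp add: power2_eq_square mult_ac)
qed

lemma harm_ge_1: "X \<ge> 1 \<Longrightarrow> harm X \<ge> (1 :: real)"
  using member_le_sum[of 1 "{1..X}" "\<lambda>g. inverse (real g)"] by (simp add: harm_def)

lemma harm_le: "X \<ge> 1 \<Longrightarrow> harm X \<le> (1 :: real) + ln (real X)"
proof -
  assume "X \<ge> 1"
  then obtain n where n: "X = Suc n" by (cases X) auto
  have "harm (Suc n) - ln (real (Suc n)) \<le> harm (Suc 0) - ln (real (Suc 0))"
    using decseqD[OF decseq_harm_diff_ln, of 0 n] by simp
  then show ?thesis by (simp add: n harm_def inverse_eq_divide)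
qed

text \<open>
  There are \<open>N ^ 2\<close> solutions with \<open>n = k\<close>. Those with \<open>n > k\<close> correspond to
  \<open>(n - k) * (n + k) = (l - m) * (l + m)\<close> with factors between 1 and \<open>2 * N\<close>, and those with \<open>n < k\<close> are
  obtained by exchanging the two sides. The count is at most \<open>N ^ 2 + 2 * (2 * N * harm (2 * N)) ^ 2\<close>.
\<close>

lemma card_equal_square_sums_le:
  assumes "N \<ge> 1"
  shows "real (card {(a,b). a \<in> {1..N}\<times>{1..N} \<and> b \<in> {1..N}\<times>{1..N} \<and>
       (case a of (n,m) \<Rightarrow> int (n\<^sup>2 + m\<^sup>2)) = (case b of (k,l) \<Rightarrow> int (k\<^sup>2 + l\<^sup>2))})
     \<le> 9 * (real N * harm (2 * N))\<^sup>2"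
proof -
  define Q where "Q = {(a,b). a \<in> {1..N}\<times>{1..N} \<and> b \<in> {1..N}\<times>{1..N} \<and>
       (case a of (n,m) \<Rightarrow> int (n\<^sup>2 + m\<^sup>2)) = (case b of (k,l) \<Rightarrow> int (k\<^sup>2 + l\<^sup>2))}"
  let ?M = "{(A,B,C,D). A \<in> {1..2*N} \<and> B \<in> {1..2*N} \<and> C \<in> {1..2*N} \<and> D \<in> {1..2*N} \<and> A * B = C * (D::nat)}"
  have Q_iff: "((n,m),(k,l)) \<in> Q \<longleftrightarrow> n \<in> {1..N} \<and> m \<in> {1..N} \<and> k \<in> {1..N} \<and> l \<in> {1..N} \<and> n\<^sup>2 + m\<^sup>2 = k\<^sup>2 + l\<^sup>2" for n m k l
    by (auto simp: Q_def simp flip: of_nat_power of_nat_add)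
  define Q0 where "Q0 = (\<lambda>a. (a,a)) ` ({1..N}\<times>{1..N})"
  define Q1 where "Q1 = {((n,m),(k,l)). ((n,m),(k,l)) \<in> Q \<and> k < n}"
  define Q2 where "Q2 = {((n,m),(k,l)). ((n,m),(k,l)) \<in> Q \<and> n < k}"
  have "?M \<subseteq> {1..2*N}\<times>{1..2*N}\<times>{1..2*N}\<times>{1..2*N}" by auto
  then have finM: "finite ?M" by (rule finite_subset) auto
  have factor: "n - k \<in> {1..2*N} \<and> n + k \<in> {1..2*N} \<and> l - m \<in> {1..2*N} \<and> l + m \<in> {1..2*N} \<and> m < l
      \<and> (n - k) * (n + k) = (l - m) * (l + m)"
    if "n \<in> {1..N}" "m \<in> {1..N}" "k \<in> {1..N}" "l \<in> {1..N}" "n\<^sup>2 + m\<^sup>2 = k\<^sup>2 + l\<^sup>2" "k < n" for n m k l :: nat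
  proof -
    have "k\<^sup>2 < n\<^sup>2" using that(6) by (intro power_strict_mono) auto
    then have "m\<^sup>2 < l\<^sup>2" using that(5) by linarith
    then have "m < l" by (simp add: power_less_imp_less_base)
    obtain a c where ac: "n = k + a" "l = m + c" using \<open>k < n\<close> \<open>m < l\<close> by (metis less_imp_add_positive)
    have "(n - k) * (n + k) = (l - m) * (l + m)" using that(5) unfolding ac
      by (simp add: power2_eq_square algebra_simps)
    then show ?thesis using that \<open>m < l\<close> by auto
  qed
  have "card Q1 \<le> card ?M"
  proof (rule card_inj_on_le[OF _ _ finM])
    show "inj_on (\<lambda>((n,m),(k,l)). (n - k, n + k, l - m, l + m)) Q1"
    proof (rule inj_onI)
      fix u v
      assume uv: "u \<in> Q1" "v \<in> Q1"
        "(\<lambda>((n,m),(k,l)). (n - k, n + k, l - m, l + m)) u = (\<lambda>((n,m),(k,l)). (n - k, n + k, l - m, l + m)) v"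
      obtain n m k l n' m' k' l' where u: "u = ((n,m),(k,l))" and v: "v = ((n',m'),(k',l'))"
        by (metis prod.exhaust)
      have Q: "((n,m),(k,l)) \<in> Q1" "((n',m'),(k',l')) \<in> Q1"
        and eq: "n - k = n' - k'" "n + k = n' + k'" "l - m = l' - m'" "l + m = l' + m'"
        using uv by (simp_all add: u v)
      have "k < n" "k' < n'" using Q by (auto simp: Q1_def)
      moreover have "m < l" using Q(1) factor[of n m k l] by (auto simp: Q1_def Q_iff)
      moreover have "m' < l'" using Q(2) factor[of n' m' k' l'] by (auto simp: Q1_def Q_iff)
      ultimately have "n = n'" "k = k'" "m = m'" "l = l'" using eq by linarith+
      then show "u = v" by (simp add: u v)
    qed
    show "(\<lambda>((n,m),(k,l)). (n - k, n + k, l - m, l + m)) ` Q1 \<subseteq> ?M"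
    proof (rule image_subsetI)
      fix u assume "u \<in> Q1"
      moreover obtain n m k l where u: "u = ((n,m),(k,l))" by (metis prod.exhaust)
      ultimately show "(\<lambda>((n,m),(k,l)). (n - k, n + k, l - m, l + m)) u \<in> ?M"
        using factor[of n m k l] by (simp add: Q1_def Q_iff)
    qed
  qed
  moreover have "card Q2 \<le> card Q1"
  proof (rule card_inj_on_le)
    show "inj_on (\<lambda>(a,b). (b,a)) Q2" by (auto simp: inj_on_def)
    show "(\<lambda>(a,b). (b,a)) ` Q2 \<subseteq> Q1" by (auto simp: Q1_def Q2_def Q_iff)
    have "Q1 \<subseteq> ({1..N}\<times>{1..N})\<times>({1..N}\<times>{1..N})" by (auto simp: Q1_def Q_iff)
    then show "finite Q1" by (rule finite_subset) auto
  qed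
  moreover have "card Q0 \<le> N\<^sup>2" unfolding Q0_def by (rule order_trans[OF card_image_le]) (auto simp: power2_eq_square)
  moreover have "card Q \<le> card Q0 + card Q1 + card Q2"
  proof -
    have "Q \<subseteq> Q0 \<union> Q1 \<union> Q2"
    proof clarify
      fix n m k l assume *: "((n,m),(k,l)) \<in> Q" "((n,m),(k,l)) \<notin> Q2" "((n,m),(k,l)) \<notin> Q1"
      then have "n = k" by (auto simp: Q1_def Q2_def)
      with * show "((n,m),(k,l)) \<in> Q0" by (auto simp: Q_iff Q0_def)
    qed
    moreover have "finite (Q0 \<union> Q1 \<union> Q2)"
      by (rule finite_subset[of _ "({1..N}\<times>{1..N})\<times>({1..N}\<times>{1..N})"]) (auto simp: Q0_def Q1_def Q2_def Q_iff)
    ultimately have "card Q \<le> card (Q0 \<union> Q1 \<union> Q2)" by (rule card_mono[rotated])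
    also have "\<dots> \<le> card Q0 + card Q1 + card Q2" by (meson card_Un_le add_le_mono order_refl order_trans)
    finally show ?thesis .
  qed
  ultimately have "card Q \<le> N\<^sup>2 + 2 * card ?M" by linarith
  then have "real (card Q) \<le> real (N\<^sup>2 + 2 * card ?M)" by (rule of_nat_mono)
  also have "\<dots> = real N ^ 2 + 2 * real (card ?M)" by simp
  also have "\<dots> \<le> real N ^ 2 * harm (2*N) ^ 2 + 2 * (real (2 * N) * harm (2*N))\<^sup>2"
  proof (intro add_mono mult_left_mono card_equal_products_le)
    have "(1 :: real) \<le> harm (2*N) ^ 2" using harm_ge_1[of "2*N"] assms by (intro one_le_power) auto
    then show "real N ^ 2 \<le> real N ^ 2 * harm (2*N) ^ 2" using mult_left_mono[of 1 _ "real N ^ 2"] by simp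
  qed auto
  also have "\<dots> = 9 * (real N * harm (2 * N))\<^sup>2" by (simp add: power_mult_distrib)
  finally show ?thesis by (simp add: Q_def)
qed

text \<open>
  The fourth power of the sum is the squared modulus of its square, which is an exponential sum
  over pairs.
\<close>

lemma integral_norm_fourth_power_le:
  fixes c :: "nat \<Rightarrow> complex"
  assumes N: "N \<ge> 1" and c: "\<And>n. n \<in> {1..N} \<Longrightarrow> norm (c n) \<le> B"
  shows "integral {0..2} (\<lambda>x. (norm (\<Sum>n\<in>{1..N}. c n * cis (pi * real_of_int (int (n\<^sup>2)) * x))) ^ 4)
     \<le> 18 * B ^ 4 * (real N * harm (2 * N))\<^sup>2"
proof -
  let ?A = "{1..N}\<times>{1..N}"
  let ?c = "\<lambda>(n,m). c n * c m" and ?\<phi> = "\<lambda>(n,m). int (n\<^sup>2 + m\<^sup>2)"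
  have B: "B \<ge> 0" using c[of 1] N by (auto intro: order_trans[OF norm_ge_zero])
  have sq: "(norm (\<Sum>n\<in>{1..N}. c n * cis (pi * real_of_int (int (n\<^sup>2)) * x))) ^ 4
     = (norm (\<Sum>a\<in>?A. ?c a * cis (pi * real_of_int (?\<phi> a) * x)))\<^sup>2" for x
  proof -
    let ?s = "\<Sum>n\<in>{1..N}. c n * cis (pi * real_of_int (int (n\<^sup>2)) * x)"
    have "?s * ?s = (\<Sum>a\<in>?A. ?c a * cis (pi * real_of_int (?\<phi> a) * x))"
      unfolding sum_product sum.cartesian_product
      by (intro sum.cong refl) (auto simp: cis_mult algebra_simps simp flip: cis_mult)
    moreover have "(norm ?s) ^ 4 = (norm (?s * ?s))\<^sup>2"
      by (simp only: norm_mult) (simp add: power4_eq_xxxx power2_eq_square)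
    ultimately show ?thesis by simp
  qed
  have "integral {0..2} (\<lambda>x. (norm (\<Sum>a\<in>?A. ?c a * cis (pi * real_of_int (?\<phi> a) * x)))\<^sup>2)
     \<le> 2 * (B\<^sup>2)\<^sup>2 * real (card {(a,b). a \<in> ?A \<and> b \<in> ?A \<and> ?\<phi> a = ?\<phi> b})"
    using c B by (intro integral_norm_sq_trig_sum_le)
      (auto simp: norm_mult power2_eq_square intro!: mult_mono)
  also have "\<dots> \<le> 2 * (B\<^sup>2)\<^sup>2 * (9 * (real N * harm (2 * N))\<^sup>2)"
    by (intro mult_left_mono card_equal_square_sums_le N) auto
  finally show ?thesis unfolding sq by (simp add: power_mult_distrib power_even_eq flip: power_mult)
qed

section \<open>Fourier coefficients of the increments\<close>

text \<open>
  The Fourier coefficients of \<open>x \<mapsto> Phi (x + h) - Phi x\<close>. Their modulus is of order \<open>h\<close> as long as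
  \<open>n\<^sup>2 * h \<le> 1\<close> and never exceeds \<open>1 / n\<^sup>2\<close>.
\<close>

definition increment_coeff :: "real \<Rightarrow> nat \<Rightarrow> complex" where
  "increment_coeff h n = (cis (pi * real n ^ 2 * h) - 1) / (of_real pi * \<i> * of_nat n ^ 2)"

lemma riemann_term_increment:
  "riemann_term n (x + h) - riemann_term n x = increment_coeff h n * cis (pi * real_of_int (int (n\<^sup>2)) * x)"
proof -
  have "cis (pi * real_of_int (int (n\<^sup>2)) * (x + h))
      = cis (pi * real n ^ 2 * h) * cis (pi * real_of_int (int (n\<^sup>2)) * x)"
    by (simp add: cis_mult algebra_simps)
  then show ?thesis
    by (simp add: riemann_term_def increment_coeff_def algebra_simps flip: diff_divide_distrib)
qed

lemma norm_increment_coeff: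
  "norm (increment_coeff h n) = 2 * \<bar>sin (pi * real n ^ 2 * h / 2)\<bar> / (pi * real n ^ 2)"
  using dist_exp_i_1[of "pi * real n ^ 2 * h"]
  by (simp add: increment_coeff_def norm_divide norm_mult norm_power cis_conv_exp)

lemma norm_increment_coeff_le:
  assumes "n > 0" "h \<ge> 0" shows "norm (increment_coeff h n) \<le> h"
proof -
  have "\<bar>sin (pi * real n ^ 2 * h / 2)\<bar> \<le> pi * real n ^ 2 * h / 2"
    using abs_sin_x_le_abs_x[of "pi * real n ^ 2 * h / 2"] assms by simp
  then show ?thesis using assms by (simp add: norm_increment_coeff field_simps)
qed

lemma norm_increment_coeff_le_inverse_square:
  assumes "n > 0" shows "norm (increment_coeff h n) \<le> 1 / real n ^ 2"
proof -
  have "2 * \<bar>sin (pi * real n ^ 2 * h / 2)\<bar> \<le> pi"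
    using abs_sin_le_one[of "pi * real n ^ 2 * h / 2"] pi_gt3 by linarith
  then have "2 * \<bar>sin (pi * real n ^ 2 * h / 2)\<bar> / (pi * real n ^ 2) \<le> pi / (pi * real n ^ 2)"
    by (intro divide_right_mono) auto
  then show ?thesis by (simp add: norm_increment_coeff)
qed

text \<open>
  By concavity the sine lies above its chord from \<open>(0, 0)\<close> to \<open>(pi / 2, 1)\<close>.
\<close>

lemma sin_ge_chord:
  assumes "0 \<le> y" "y \<le> pi / 2"
  shows "2 * y / pi \<le> sin y"
proof -
  have conc: "concave_on {0..pi/2} (sin :: real \<Rightarrow> real)"
    by (rule f''_le0_imp_concave[where f' = cos and f'' = "\<lambda>x. - sin x"])
       (auto intro!: derivative_eq_intros sin_ge_zero)
  have "sin ((1 - 2 * y / pi) *\<^sub>R 0 + (2 * y / pi) *\<^sub>R (pi / 2)) \<ge> (1 - 2 * y / pi) * sin 0 + (2 * y / pi) * sin (pi / 2)"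
    using assms by (intro concave_onD[OF conc]) (auto simp: field_simps)
  then show ?thesis by simp
qed

lemma norm_increment_coeff_ge:
  assumes "n > 0" "h \<ge> 0" "real n ^ 2 * h \<le> 1"
  shows "norm (increment_coeff h n) \<ge> 2 * h / pi"
proof -
  have "pi * (real n ^ 2 * h) \<le> pi * 1" using assms(3) by (intro mult_left_mono) auto
  then have "2 * (pi * real n ^ 2 * h / 2) / pi \<le> sin (pi * real n ^ 2 * h / 2)"
    using assms by (intro sin_ge_chord) (auto simp: mult_ac)
  then have "real n ^ 2 * h \<le> \<bar>sin (pi * real n ^ 2 * h / 2)\<bar>" by simp
  then show ?thesis using assms by (simp add: norm_increment_coeff field_simps)
qed

text \<open>
  The tail is compared with the telescoping series of \<open>1 / (n - 1) - 1 / n\<close>; the factor \<open>1/2\<close> comes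
  from \<open>pi \<ge> 2\<close>.
\<close>

lemma norm_Phi_minus_partial_sum_le:
  assumes "M > 0"
  shows "norm (Phi x - (\<Sum>n\<in>{1..M}. riemann_term n x)) \<le> 1 / (2 * real M)"
proof -
  have shift: "(\<Sum>k<L. riemann_term (Suc k) x) = (\<Sum>n\<in>{1..L}. riemann_term n x)" for L
    by (rule sum.reindex_bij_witness[of _ "\<lambda>n. n - 1" Suc]) auto
  have lim: "(\<lambda>L. \<Sum>n\<in>{1..L}. riemann_term n x) \<longlonglongrightarrow> Phi x"
    using Phi_sums[of x] unfolding sums_def shift .
  have bound: "norm ((\<Sum>n\<in>{1..M+i}. riemann_term n x) - (\<Sum>n\<in>{1..M}. riemann_term n x)) \<le> 1 / 2 * (1 / real M - 1 / real (M + i))" for i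
  proof (induction i)
    case (Suc i)
    let ?S = "\<lambda>L. \<Sum>n\<in>{1..L}. riemann_term n x"
    have "norm (?S (M + Suc i) - ?S M) \<le> norm (?S (M + i) - ?S M) + norm (riemann_term (M + Suc i) x)"
      using norm_triangle_ineq[of "?S (M + i) - ?S M" "riemann_term (M + Suc i) x"]
      by (simp add: algebra_simps)
    also have "norm (riemann_term (M + Suc i) x) \<le> 1 / 2 * (1 / real (M + i) - 1 / real (M + Suc i))"
    proof -
      have "2 * (real (M + i) * real (M + Suc i)) \<le> pi * (real (M + Suc i) * real (M + Suc i))"
        using pi_gt3 by (intro mult_mono) auto
      then have "1 / (pi * real (M + Suc i) ^ 2) \<le> 1 / (2 * (real (M + i) * real (M + Suc i)))"
        using assms by (intro divide_left_mono) (auto simp: power2_eq_square)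
      also have "\<dots> = 1 / 2 * (1 / real (M + i) - 1 / real (M + Suc i))"
        using assms by (simp add: field_simps)
      finally show ?thesis by (simp only: norm_riemann_term)
    qed
    finally show ?case using Suc.IH by (simp add: algebra_simps)
  qed simp
  have "norm ((\<Sum>n\<in>{1..L}. riemann_term n x) - (\<Sum>n\<in>{1..M}. riemann_term n x)) \<le> 1 / (2 * real M)" if "L \<ge> M" for L
  proof -
    have "1 / 2 * (1 / real M - 1 / real L) \<le> 1 / (2 * real M)" by (simp add: field_simps)
    then show ?thesis
      by (rule order_trans[OF bound[of "L - M", unfolded le_add_diff_inverse[OF that]]])
  qed
  moreover have "(\<lambda>L. norm ((\<Sum>n\<in>{1..L}. riemann_term n x) - (\<Sum>n\<in>{1..M}. riemann_term n x)))
      \<longlonglongrightarrow> norm (Phi x - (\<Sum>n\<in>{1..M}. riemann_term n x))"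
    by (intro tendsto_intros lim)
  ultimately show ?thesis by (intro LIMSEQ_le_const2) blast+
qed

lemma norm_increment_minus_trig_sum_le:
  assumes "M > 0"
  shows "norm (Phi (x + h) - Phi x - (\<Sum>n\<in>{1..M}. increment_coeff h n * cis (pi * real_of_int (int (n\<^sup>2)) * x))) \<le> 1 / real M"
proof -
  let ?S = "\<lambda>x. \<Sum>n\<in>{1..M}. riemann_term n x"
  have "Phi (x + h) - Phi x - (\<Sum>n\<in>{1..M}. increment_coeff h n * cis (pi * real_of_int (int (n\<^sup>2)) * x))
      = (Phi (x + h) - ?S (x + h)) - (Phi x - ?S x)"
    by (simp only: sum_subtractf flip: riemann_term_increment) simp
  also have "norm \<dots> \<le> 1 / (2 * real M) + 1 / (2 * real M)"
    by (intro order_trans[OF norm_triangle_ineq4] add_mono norm_Phi_minus_partial_sum_le[OF assms])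
  finally show ?thesis by simp
qed

section \<open>Infinite variation below the critical exponent\<close>

text \<open>
  This interpolates \<open>L\<^sup>2\<close> between \<open>L\<^sup>p\<close> and \<open>L\<^sup>4\<close> pointwise, with a threshold \<open>T\<close>. The function of
  interest is \<open>F\<close>, a sum of \<open>P\<close>, \<open>Q\<close> and an error of size \<open>\<sigma>\<close>. The fourth moment is only
  needed for the main part \<open>P\<close>, while the \<open>p\<close>-th power refers to \<open>F\<close>. If \<open>P\<close> is less than twice
  \<open>|F - P|\<close>, the last two terms dominate; if it is larger than \<open>T\<close>, the fourth power does; otherwise
  \<open>F\<close> is comparable to \<open>P\<close>.
\<close>

lemma square_norm_main_part_le:
  fixes P Q F :: complex
  assumes p: "1 \<le> p" "p \<le> 2" and T: "T > 0" and S: "norm (F - (P + Q)) \<le> \<sigma>"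
  shows "(norm P)\<^sup>2 \<le> 4 * T powr (2 - p) * norm F powr p + (norm P) ^ 4 / T\<^sup>2 + 8 * (norm Q)\<^sup>2 + 8 * \<sigma>\<^sup>2"
proof -
  define R where "R = F - P"
  have "norm R \<le> norm Q + \<sigma>"
    using norm_triangle_ineq[of "F - (P + Q)" Q] S by (simp add: R_def algebra_simps)
  then have "(norm R)\<^sup>2 \<le> (norm Q + \<sigma>)\<^sup>2" by (intro power_mono) auto
  also have "\<dots> \<le> 2 * (norm Q)\<^sup>2 + 2 * \<sigma>\<^sup>2"
    using sum_squares_bound[of "norm Q" \<sigma>] by (simp add: power2_sum)
  finally have R: "4 * (norm R)\<^sup>2 \<le> 8 * (norm Q)\<^sup>2 + 8 * \<sigma>\<^sup>2" by simp
  have nn: "0 \<le> 4 * T powr (2 - p) * norm F powr p" "0 \<le> (norm P) ^ 4 / T\<^sup>2" "0 \<le> 8 * (norm Q)\<^sup>2" "0 \<le> 8 * \<sigma>\<^sup>2"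
    by auto
  consider "norm P \<le> 2 * norm R" | "norm P > 2 * norm R" "norm P > T" | "norm P > 2 * norm R" "norm P \<le> T"
    by linarith
  then show ?thesis
  proof cases
    case 1
    then have "(norm P)\<^sup>2 \<le> (2 * norm R)\<^sup>2" by (intro power_mono) auto
    then have "(norm P)\<^sup>2 \<le> 4 * (norm R)\<^sup>2" by (simp add: power_mult_distrib)
    then show ?thesis using R nn by linarith
  next
    case 2
    have "(norm P)\<^sup>2 * T\<^sup>2 \<le> (norm P)\<^sup>2 * (norm P)\<^sup>2" using 2 T by (intro mult_left_mono power_mono) auto
    then have "(norm P)\<^sup>2 \<le> (norm P) ^ 4 / T\<^sup>2" using T by (simp add: field_simps flip: power_add)
    then show ?thesis using nn by linarith
  next
    case 3
    have PF: "norm P \<le> 2 * norm F" using 3 norm_triangle_ineq2[of P "P - F"] by (simp add: R_def norm_minus_commute)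
    have pos: "norm P > 0" using 3(1) by (smt (verit) norm_ge_zero)
    have "(norm P)\<^sup>2 = norm P powr (2 - p) * norm P powr p" using pos by (simp flip: powr_add)
    also have "\<dots> \<le> T powr (2 - p) * (2 * norm F) powr p"
      using 3 p PF by (intro mult_mono powr_mono2) auto
    also have "\<dots> \<le> T powr (2 - p) * (4 * norm F powr p)"
    proof (intro mult_left_mono)
      have "(2::real) powr p \<le> 2 powr 2" using p by (intro powr_mono) auto
      then show "(2 * norm F) powr p \<le> 4 * norm F powr p" by (simp add: powr_mult mult_right_mono)
    qed auto
    finally have "(norm P)\<^sup>2 \<le> 4 * T powr (2 - p) * norm F powr p" by (simp add: mult_ac)
    then show ?thesis using nn by linarith
  qed
qed

text \<open>
  Variation bounds control sums over translates of a comb \<open>s, s + d, s + 2 * d, \<dots>\<close>; integrating over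
  the offset \<open>s\<close> turns them into a bound for an integral over the whole interval.
\<close>

lemma integral_le_of_translate_sums:
  fixes G :: "real \<Rightarrow> real"
  assumes d: "d \<ge> 0" and cont: "continuous_on UNIV G"
    and le: "\<And>s. s \<in> {0..d} \<Longrightarrow> (\<Sum>k<M. G (s + real k * d)) \<le> B"
  shows "integral {0..real M * d} G \<le> d * B"
proof -
  have int: "G integrable_on {a..b}" for a b
    by (intro integrable_continuous_interval continuous_on_subset[OF cont]) auto
  have contk: "continuous_on A (\<lambda>s. G (s + real k * d))" for k A
    by (rule continuous_on_compose2[OF cont]) (auto intro!: continuous_intros)
  have "integral {0..real m * d} G = (\<Sum>k<m. integral {0..d} (\<lambda>s. G (s + real k * d)))" for m
  proof (induction m)
    case (Suc m)
    have "integral {0..real (Suc m) * d} G = integral {0..real m * d} G + integral {real m * d..real (Suc m) * d} G"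
      using d by (intro Henstock_Kurzweil_Integration.integral_combine[symmetric] int)
        (auto simp: mult_right_mono algebra_simps)
    also have "integral {real m * d..real (Suc m) * d} G = integral {0..d} (\<lambda>s. G (s + real m * d))"
      using integral_shift_real_ivl[of "real m * d" "real m * d" "real (Suc m) * d" G] by (simp add: algebra_simps)
    finally show ?case using Suc by simp
  qed simp
  then have "integral {0..real M * d} G = integral {0..d} (\<lambda>s. \<Sum>k<M. G (s + real k * d))"
    by (simp add: integral_sum integrable_continuous_interval contk)
  also have "\<dots> \<le> integral {0..d} (\<lambda>s. B)"
    using le by (intro integral_le integrable_continuous_interval continuous_intros contk) auto
  also have "\<dots> = d * B" using d by simp
  finally show ?thesis .
qed

text \<open>
  The segments of length \<open>h\<close> starting at \<open>s + 2 * h * k\<close> are separated by gaps of length \<open>h\<close>, hence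
  disjoint. All of them lie in \<open>[0, 2]\<close> except possibly the last one, which is treated on its own
  by periodicity; this is why the bound is \<open>2 * C\<close> and not \<open>C\<close>.
\<close>

lemma sum_increments_Phi_comb_le:
  fixes C h :: real and m :: nat
  assumes C: "\<And>(J :: nat set) x y. separated_segments 2 J x y \<Longrightarrow>
           (\<Sum>j\<in>J. norm (Phi (y j) - Phi (x j)) powr p) \<le> C"
    and h: "h > 0" and m: "real m * (2 * h) = 2" and s: "s \<in> {0..2*h}"
  shows "(\<Sum>k<m. norm (Phi (s + real k * (2*h) + h) - Phi (s + real k * (2*h))) powr p) \<le> 2 * C"
proof -
  have m0: "m > 0" using m by (auto intro!: gr0I)
  then obtain m' where m': "m = Suc m'" by (cases m) auto
  let ?x = "\<lambda>k. s + real k * (2*h)"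
  let ?a = "\<lambda>k. norm (Phi (?x k + h) - Phi (?x k)) powr p"
  have single: "norm (Phi b - Phi a) powr p \<le> C" if "0 \<le> a" "a \<le> b" "b \<le> 2" for a b
    using C[of "{0}" "\<lambda>_. a" "\<lambda>_. b"] that by (auto simp: separated_segments_def disjoint_family_on_def)
  have "(\<Sum>k<m'. ?a k) \<le> C"
  proof (rule C)
    show "separated_segments 2 {..<m'} ?x (\<lambda>k. ?x k + h)"
      unfolding separated_segments_def
    proof (intro conjI ballI)
      fix k assume "k \<in> {..<m'}"
      then have "real (k + 2) \<le> real m" using m' by simp
      then have "real (k + 2) * (2 * h) \<le> 2" using h m by (metis mult_right_mono less_eq_real_def mult_pos_pos zero_less_numeral)
      then show "?x k + h \<le> 2" using s h by (auto simp: algebra_simps)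
    next
      have lt: "?x k + h < ?x k'" if "k < k'" for k k' :: nat
      proof -
        have "real (k + 1) * (2 * h) \<le> real k' * (2 * h)" using that h by (intro mult_right_mono) auto
        then show ?thesis using h by (simp add: algebra_simps)
      qed
      show "disjoint_family_on (\<lambda>k. {?x k..?x k + h}) {..<m'}"
        unfolding disjoint_family_on_def
      proof (intro ballI impI)
        fix k k' :: nat assume "k \<noteq> k'"
        then consider "k < k'" | "k' < k" by linarith
        then show "{?x k..?x k + h} \<inter> {?x k'..?x k' + h} = {}"
          using lt[of k k'] lt[of k' k] by cases auto
      qed
    qed (use s h in auto)
  qed
  moreover have "?a m' \<le> C"
  proof (cases "?x m' + h \<le> 2")
    case True then show ?thesis using s h by (intro single) auto
  next
    case False
    have "real m' * (2 * h) = 2 - 2 * h" using m by (simp add: m' algebra_simps)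
    \<comment> \<open>Shifted back by a period, the right endpoint falls to the left of the starting point.\<close>
    moreover have "Phi (?x m' + h) = Phi (?x m' + h - 2)" using Phi_periodic[of "?x m' + h - 2"] by simp
    moreover have "h \<le> 1" 
    proof -
      have "1 * h \<le> real m * h" using m0 h by (intro mult_right_mono) auto
      then show ?thesis using m by simp
    qed
    ultimately show ?thesis using False s h single[of "?x m' + h - 2" "?x m'"]
      by (simp add: norm_minus_commute)
  qed
  ultimately show ?thesis by (simp add: m')
qed

text \<open>
  Already the \<open>K\<close> terms with \<open>n \<le> K\<close>, for which \<open>n\<^sup>2 * h \<le> 1\<close>, have coefficients at least
  \<open>2 * h / pi\<close> and give this lower bound.
\<close>

lemma mean_square_main_part_ge:
  fixes K :: nat
  assumes K: "K > 0"
  defines "h \<equiv> 1 / real K ^ 2"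
  shows "4 / 5 / real K ^ 3 \<le> integral {0..2} (\<lambda>x. (norm (\<Sum>n\<in>{1..4*K}. increment_coeff h n * cis (pi * real_of_int (int (n\<^sup>2)) * x)))\<^sup>2)"
proof -
  have h: "h > 0" using K by (simp add: h_def)
  have "4 / 5 / real K ^ 3 \<le> 8 / pi ^ 2 / real K ^ 3"
  proof (rule divide_right_mono)
    have "pi ^ 2 \<le> (3.16::real) ^ 2" using pi_approx by (intro power_mono) auto
    then have "pi ^ 2 \<le> 10" by (simp add: power2_eq_square)
    then show "4 / 5 \<le> 8 / pi ^ 2" by (simp add: field_simps)
  qed simp
  also have "\<dots> = 2 * (\<Sum>n\<in>{1..K}. (2 * h / pi) ^ 2)"
    using K by (simp add: h_def field_simps power_numeral_reduce)
  also have "\<dots> \<le> 2 * (\<Sum>n\<in>{1..K}. (norm (increment_coeff h n)) ^ 2)"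
  proof (intro mult_left_mono sum_mono power_mono)
    fix n assume n: "n \<in> {1..K}"
    then have "real n ^ 2 \<le> real K ^ 2" by (intro power_mono) auto
    then show "2 * h / pi \<le> norm (increment_coeff h n)"
      using n h K by (intro norm_increment_coeff_ge) (auto simp: h_def)
  qed (use h in auto)
  also have "\<dots> \<le> 2 * (\<Sum>n\<in>{1..4*K}. (norm (increment_coeff h n)) ^ 2)"
    by (intro mult_left_mono sum_mono2) auto
  also have "\<dots> = integral {0..2} (\<lambda>x. (norm (\<Sum>n\<in>{1..4*K}. increment_coeff h n * cis (pi * real_of_int (int (n\<^sup>2)) * x)))\<^sup>2)"
    by (rule integral_norm_sq_trig_sum_inj[OF _ inj_on_int_square, symmetric]) simp
  finally show ?thesis .
qed

lemma sum_inverse_fourth_powers_le: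
  assumes "N > 0"
  shows "(\<Sum>n\<in>{Suc N..M}. 1 / real n ^ 4) \<le> 1 / real N ^ 3"
proof -
  have "(\<Sum>n\<in>{Suc N..N+i}. 1 / real n ^ 4) \<le> 1 / real N ^ 2 * (1 / real N - 1 / real (N + i))" for i
  proof (induction i)
    case (Suc i)
    have "real N ^ 2 * (real (N + i) * real (N + Suc i)) \<le> real (N + Suc i) ^ 2 * (real (N + Suc i) * real (N + Suc i))"
      by (intro mult_mono power_mono) auto
    then have "1 / real (N + Suc i) ^ 4 \<le> 1 / (real N ^ 2 * (real (N + i) * real (N + Suc i)))"
      using assms by (intro divide_left_mono) (auto simp: power2_eq_square power4_eq_xxxx mult.assoc)
    also have "\<dots> = 1 / real N ^ 2 * (1 / real (N + i) - 1 / real (N + Suc i))"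
      using assms by (simp add: field_simps)
    finally show ?case using Suc.IH by (simp add: algebra_simps)
  qed simp
  note * = this
  show ?thesis
  proof (cases "M \<le> N")
    case False
    then have "(\<Sum>n\<in>{Suc N..M}. 1 / real n ^ 4) \<le> 1 / real N ^ 2 * (1 / real N - 1 / real M)"
      using *[of "M - N"] by simp
    also have "\<dots> \<le> 1 / real N ^ 2 * (1 / real N)" by (intro mult_left_mono) auto
    finally show ?thesis by (simp add: power_numeral_reduce mult_ac)
  qed simp
qed

lemma mean_square_tail_le:
  assumes "N > 0"
  shows "integral {0..2} (\<lambda>x. (norm (\<Sum>n\<in>{Suc N..M}. increment_coeff h n * cis (pi * real_of_int (int (n\<^sup>2)) * x)))\<^sup>2)
     \<le> 2 / real N ^ 3"
proof -
  have "integral {0..2} (\<lambda>x. (norm (\<Sum>n\<in>{Suc N..M}. increment_coeff h n * cis (pi * real_of_int (int (n\<^sup>2)) * x)))\<^sup>2)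
      = 2 * (\<Sum>n\<in>{Suc N..M}. (norm (increment_coeff h n))\<^sup>2)"
    by (rule integral_norm_sq_trig_sum_inj[OF _ inj_on_int_square]) simp
  also have "\<dots> \<le> 2 * (\<Sum>n\<in>{Suc N..M}. 1 / real n ^ 4)"
  proof (intro mult_left_mono sum_mono)
    fix n assume "n \<in> {Suc N..M}"
    then have "(norm (increment_coeff h n))\<^sup>2 \<le> (1 / real n ^ 2)\<^sup>2"
      by (intro power_mono norm_increment_coeff_le_inverse_square) auto
    then show "(norm (increment_coeff h n))\<^sup>2 \<le> 1 / real n ^ 4"
      by (simp add: power_divide flip: power_mult)
  qed auto
  also have "\<dots> \<le> 2 * (1 / real N ^ 3)" by (intro mult_left_mono sum_inverse_fourth_powers_le assms) auto
  finally show ?thesis by simp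
qed

text \<open>
  If all variation sums are at most \<open>C\<close>, then \<open>C\<close> is at least a power of \<open>K\<close> up to a logarithm,
  where \<open>h = 1 / K ^ 2\<close> is the step. The constants serve the budget for the mean square of the main
  part, in units of \<open>1 / K ^ 3\<close>: it is at least \<open>4/5\<close>, of which at most \<open>1/10\<close> is due to large values
  (choice of \<open>T\<close>), at most \<open>1/4\<close> to the frequencies beyond \<open>N = 4 * K\<close>, and at most \<open>1/16\<close> to the
  tail beyond \<open>M = 16 * K ^ 2\<close>. What remains is positive and must be accounted for by the variation.
\<close>

lemma variation_lower_bound:
  fixes C :: real and K :: nat
  assumes C: "\<And>(J :: nat set) x y. separated_segments 2 J x y \<Longrightarrow>
           (\<Sum>j\<in>J. norm (Phi (y j) - Phi (x j)) powr p) \<le> C"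
    and p: "1 \<le> p" "p \<le> 2" and K: "K > 0"
  shows "real K powr (2 - 3 * p / 2) \<le> 15360 * C * (1 + ln (8 * real K))"
proof -
  define h where "h = 1 / real K ^ 2"
  define N where "N = 4 * K"
  define M where "M = 16 * K ^ 2"
  define \<sigma> where "\<sigma> = 1 / real M"
  define H :: real where "H = harm (8 * K)"
  \<comment> \<open>The typical size h powr (3/4) of the increments, enlarged by the logarithm in the fourth moment.\<close>
  define T where "T = 60 * H * real K powr (-3/2)"
  have H1: "H \<ge> 1" unfolding H_def using K by (intro harm_ge_1) auto
  have T: "T > 0" using H1 K by (simp add: T_def)
  have h: "h > 0" using K by (simp add: h_def)
  have C0: "C \<ge> 0" using C[of "{}"] by (simp add: separated_segments_def disjoint_family_on_def)
  define P where "P x = (\<Sum>n\<in>{1..N}. increment_coeff h n * cis (pi * real_of_int (int (n\<^sup>2)) * x))" for x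
  define Q where "Q x = (\<Sum>n\<in>{Suc N..M}. increment_coeff h n * cis (pi * real_of_int (int (n\<^sup>2)) * x))" for x
  have contP: "continuous_on A P" and contQ: "continuous_on A Q" for A
    unfolding P_def[abs_def] Q_def[abs_def] by (intro continuous_intros)+
  have "K \<le> K * K" using K by simp
  then have NM: "N \<le> M" unfolding N_def M_def power2_eq_square by linarith
  have PQ: "norm (Phi (x + h) - Phi x - (P x + Q x)) \<le> \<sigma>" for x
  proof -
    have "{1..M} = {1..N} \<union> {Suc N..M}" using NM by auto
    then have "P x + Q x = (\<Sum>n\<in>{1..M}. increment_coeff h n * cis (pi * real_of_int (int (n\<^sup>2)) * x))"
      unfolding P_def Q_def by (simp only:) (rule sum.union_disjoint[symmetric], auto)
    moreover have "M > 0" using K by (simp add: M_def)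
    ultimately show ?thesis unfolding \<sigma>_def by (simp only: norm_increment_minus_trig_sum_le)
  qed
  define G where "G x = (norm (P x))\<^sup>2 - (norm (P x)) ^ 4 / T\<^sup>2 - 8 * (norm (Q x))\<^sup>2" for x
  \<comment> \<open>Everything that involves Phi is moved to the right-hand side; the exponential sums that remain in G are continuous and can be integrated.\<close>
  have G_le: "G x \<le> 4 * T powr (2 - p) * norm (Phi (x + h) - Phi x) powr p + 8 * \<sigma>\<^sup>2" for x
    using square_norm_main_part_le[OF p T PQ, of x] unfolding G_def by linarith
  define d where "d = 2 * h"
  have Kd: "real (K ^ 2) * d = 2" using K by (simp add: d_def h_def)
  have "integral {0..real (K ^ 2) * d} G \<le> d * (4 * T powr (2 - p) * (2 * C) + real (K ^ 2) * (8 * \<sigma>\<^sup>2))"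
  proof (rule integral_le_of_translate_sums)
    show "continuous_on UNIV G" unfolding G_def[abs_def] using T by (intro continuous_intros contP contQ) auto
    fix s assume s: "s \<in> {0..d}"
    have "(\<Sum>k<K ^ 2. G (s + real k * d))
        \<le> (\<Sum>k<K ^ 2. 4 * T powr (2 - p) * norm (Phi (s + real k * d + h) - Phi (s + real k * d)) powr p + 8 * \<sigma>\<^sup>2)"
      by (intro sum_mono G_le)
    also have "\<dots> = 4 * T powr (2 - p) * (\<Sum>k<K ^ 2. norm (Phi (s + real k * d + h) - Phi (s + real k * d)) powr p)
        + real (K ^ 2) * (8 * \<sigma>\<^sup>2)"
      by (simp add: sum.distrib sum_distrib_left)
    also have "\<dots> \<le> 4 * T powr (2 - p) * (2 * C) + real (K ^ 2) * (8 * \<sigma>\<^sup>2)"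
      using sum_increments_Phi_comb_le[OF C h, of "K ^ 2" s] s Kd unfolding d_def
      by (intro add_right_mono mult_left_mono) auto
    finally show "(\<Sum>k<K ^ 2. G (s + real k * d)) \<le> 4 * T powr (2 - p) * (2 * C) + real (K ^ 2) * (8 * \<sigma>\<^sup>2)" .
  qed (use h in \<open>simp add: d_def\<close>)
  also have "\<dots> = 16 * h * C * T powr (2 - p) + 16 * \<sigma>\<^sup>2"
  proof -
    have "d * (4 * T powr (2 - p) * (2 * C) + real (K ^ 2) * (8 * \<sigma>\<^sup>2))
       = d * (4 * T powr (2 - p) * (2 * C)) + (real (K ^ 2) * d) * (8 * \<sigma>\<^sup>2)" by (simp add: algebra_simps)
    then show ?thesis unfolding Kd by (simp add: d_def)
  qed
  finally have G_int: "integral {0..2} G \<le> 16 * h * C * T powr (2 - p) + 16 * \<sigma>\<^sup>2" unfolding Kd .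
  have "integral {0..2} G = integral {0..2} (\<lambda>x. (norm (P x))\<^sup>2) - integral {0..2} (\<lambda>x. (norm (P x)) ^ 4) / T\<^sup>2
      - 8 * integral {0..2} (\<lambda>x. (norm (Q x))\<^sup>2)"
  proof -
    have "(\<lambda>x. (norm (P x))\<^sup>2) integrable_on {0..2}" "(\<lambda>x. (norm (P x)) ^ 4 / T\<^sup>2) integrable_on {0..2}"
      "(\<lambda>x. 8 * (norm (Q x))\<^sup>2) integrable_on {0..2}"
      using T by (intro integrable_continuous_interval continuous_intros contP contQ; simp)+
    then show ?thesis unfolding G_def[abs_def] by (simp add: integral_diff integrable_diff)
  qed
  moreover have "4 / 5 / real K ^ 3 \<le> integral {0..2} (\<lambda>x. (norm (P x))\<^sup>2)"
    unfolding P_def N_def h_def by (rule mean_square_main_part_ge[OF K])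
  moreover have "integral {0..2} (\<lambda>x. (norm (P x)) ^ 4) / T\<^sup>2 \<le> 1 / 10 / real K ^ 3"
  proof -
    have "integral {0..2} (\<lambda>x. (norm (P x)) ^ 4) \<le> 18 * h ^ 4 * (real N * harm (2 * N))\<^sup>2"
      unfolding P_def using K h by (intro integral_norm_fourth_power_le norm_increment_coeff_le) (auto simp: N_def)
    also have "\<dots> = 288 * H\<^sup>2 / real K ^ 6"
      using K by (simp add: h_def N_def H_def power_mult_distrib field_simps power_numeral_reduce)
    also have "\<dots> \<le> 1 / 10 / real K ^ 3 * T\<^sup>2"
    proof -
      have "(real K powr (-3/2))\<^sup>2 = 1 / real K ^ 3"
        using K powr_add[of "real K" "-3/2" "-3/2"] powr_neg_numeral[of "real K" "num.Bit1 num.One"]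
        by (simp add: power2_eq_square)
      then have "T\<^sup>2 = 3600 * H\<^sup>2 / real K ^ 3" by (simp add: T_def power_mult_distrib)
      then show ?thesis using K by (simp add: field_simps power_numeral_reduce)
    qed
    finally show ?thesis using T by (simp add: divide_le_eq)
  qed
  moreover have "8 * integral {0..2} (\<lambda>x. (norm (Q x))\<^sup>2) \<le> 1 / 4 / real K ^ 3"
  proof -
    have "8 * integral {0..2} (\<lambda>x. (norm (Q x))\<^sup>2) \<le> 8 * (2 / real N ^ 3)"
      unfolding Q_def using K by (intro mult_left_mono mean_square_tail_le) (auto simp: N_def)
    also have "\<dots> = 1 / 4 / real K ^ 3" by (simp add: N_def power_mult_distrib)
    finally show ?thesis .
  qed
  moreover have "16 * \<sigma>\<^sup>2 \<le> 1 / 16 / real K ^ 3"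
  proof -
    have "16 * \<sigma>\<^sup>2 = 1 / 16 / real K ^ 4" by (simp add: \<sigma>_def M_def power_divide power_mult_distrib flip: power_mult)
    also have "\<dots> \<le> 1 / 16 / real K ^ 3" using K by (intro divide_left_mono power_increasing) auto
    finally show ?thesis .
  qed
  ultimately have "(4/5 - 1/10 - 1/4 - 1/16) / real K ^ 3 \<le> 16 * h * C * T powr (2 - p)"
    using G_int by (simp add: diff_divide_distrib)
  moreover have "1 / 16 / real K ^ 3 \<le> (4/5 - 1/10 - 1/4 - 1/16) / real K ^ 3" by (intro divide_right_mono) auto
  ultimately have "1 / 16 / real K ^ 3 \<le> 16 * h * C * T powr (2 - p)" by linarith
  \<comment> \<open>Since p is at least 1, raising 60 * H to the power 2 - p does not increase it.\<close>
  also have "T powr (2 - p) \<le> 60 * H * real K powr (-3/2 * (2 - p))"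
  proof -
    have "(60 * H) powr (2 - p) \<le> (60 * H) powr 1" using p H1 by (intro powr_mono) auto
    then show ?thesis unfolding T_def using H1 by (subst powr_mult) (auto simp: powr_powr intro!: mult_right_mono)
  qed
  finally have "1 / 16 / real K ^ 3 \<le> 16 * h * C * (60 * H * real K powr (-3/2 * (2 - p)))"
    using h C0 by (simp add: mult_left_mono)
  then have "real K ^ 3 * (1 / 16 / real K ^ 3) \<le> real K ^ 3 * (16 * h * C * (60 * H * real K powr (-3/2 * (2 - p))))"
    by (intro mult_left_mono) auto
  also have "real K ^ 3 * (16 * h * C * (60 * H * real K powr (-3/2 * (2 - p)))) = 960 * C * H * (real K * real K powr (-3/2 * (2 - p)))"
    using K by (simp add: h_def field_simps power_numeral_reduce)
  also have "real K * real K powr (-3/2 * (2 - p)) = real K powr (1 + -3/2 * (2 - p))"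
    using K by (simp only: powr_add) simp
  also have "1 + -3/2 * (2 - p) = - (2 - 3 * p / 2)" by (simp add: field_simps)
  finally have "1 / 16 \<le> 960 * C * H * real K powr (- (2 - 3 * p / 2))" using K by simp
  then have "real K powr (2 - 3 * p / 2) \<le> 15360 * C * H"
    using K by (simp add: powr_minus field_simps)
  also have "\<dots> \<le> 15360 * C * (1 + ln (8 * real K))"
    using harm_le[of "8 * K"] K C0 by (intro mult_left_mono) (auto simp: H_def)
  finally show ?thesis .
qed

text \<open>
  The exponent \<open>2 - 3 * p / 2\<close> is positive exactly for \<open>p < 4/3\<close>, and then the power of \<open>K\<close> outgrows
  the logarithm.
\<close>

lemma Phi_notin_BV:
  assumes p: "1 \<le> p" "p < 4 / 3"
  shows "Phi \<notin> BV p 2"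
proof
  assume "Phi \<in> BV p 2"
  from variation_sums_bounded[OF this p(1)] obtain C
    where C: "\<And>(J :: nat set) x y. separated_segments 2 J x y \<Longrightarrow>
           (\<Sum>j\<in>J. norm (Phi (y j) - Phi (x j)) powr p) \<le> C" by blast
  define e where "e = 2 - 3 * p / 2"
  have e: "e > 0" using p by (simp add: e_def)
  have "((\<lambda>K. (1 + ln (8 * real K)) / real K powr e) \<longlongrightarrow> 0) sequentially"
    using e by real_asymp
  then have "((\<lambda>K. 15360 * C * ((1 + ln (8 * real K)) / real K powr e)) \<longlongrightarrow> 15360 * C * 0) sequentially"
    by (rule tendsto_mult_left)
  moreover have "eventually (\<lambda>K. 1 \<le> 15360 * C * ((1 + ln (8 * real K)) / real K powr e)) sequentially"
    using eventually_gt_at_top[of 0]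
  proof eventually_elim
    case (elim K)
    then show ?case using variation_lower_bound[OF C p(1) _ elim] p(2) by (simp add: e_def field_simps)
  qed
  ultimately have "1 \<le> 15360 * C * 0" by (rule tendsto_lowerbound) simp
  then show False by simp
qed

theorem theorem1p2:
  fixes p :: real
  assumes "1 \<le> p"
  shows "(p < 4 / 3 \<longrightarrow> Phi \<notin> BV p 2) \<and> (p > 4 / 3 \<longrightarrow> Phi \<in> BV p 2)"
  using assms Phi_notin_BV Phi_in_BV by blast

end
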